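(* Let $m\in\mathbb{R}$, $m\neq 0$, let $s\in\{1,\dots,7\}$, and let $S_s$ be a solvable Lie group with Lie algebra $\mathfrak{cp}_s^m$ (structure equations in the context, with respect to a basis $\{e^1,\dots,e^7\}$ of left-invariant $1$-forms). Let $\varphi(t)$ and $\widetilde\varphi(t)$ be the two families of left-invariant $\mathrm{G}_2$-structures on $S_s$ given by $$\varphi(t)=x^{127}+x^{347}+x^{567}+x^{135}-x^{146}-x^{236}-x^{245},\qquad x^i=f_i(t)e^i,\quad f_i(t)=(1-\alpha\,m^2t)^{\beta_i},$$ $$\widetilde\varphi(t)=\widetilde x^{127}+\widetilde x^{347}+\widetilde x^{567}+\widetilde x^{135}-\widetilde x^{146}-\widetilde x^{236}-\widetilde x^{245},\qquad \widetilde x^i=\widetilde f_i(t)e^i,\quad \widetilde f_i(t)=(1-\gamma\,m^2t)^{\delta_i},$$ for $i=1,\dots,7$, with real parameters $\alpha,\beta_1,\dots,\beta_7,\gamma,\delta_1,\dots,\delta_7$ such that $\beta_7=\delta_7=\tfrac12$ and $\sum_{j=1}^7\beta_j\neq 2$; here $\varphi(t)$ is considered for those $t$ with $1-\alpha m^2t>0$ and $\widetilde\varphi(t)$ for those $t$ with $1-\gamma m^2t>0$. Suppose that the parameters are related by $$\gamma=\alpha\left(\frac{2-\sum_{i=1}^7\beta_i}{2}\right),\qquad \delta_i=\frac12+\frac{1-2\beta_i}{-2+\sum_{j=1}^7\beta_j},\quad i\in\{1,\dots,7\}.$$ Then: (i) $\varphi(t)$ is locally conformal parallel (for all $t$) if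 and only if $\widetilde\varphi(t)$ is locally conformal parallel (for all $t$). (ii) $\varphi(t)$ solves the Laplacian LCP-flow $$\frac{d}{dt}\varphi(t)=\Delta_t\varphi(t),\qquad \varphi(t)\ \text{locally conformal parallel for every }t,$$ if and only if $\widetilde\psi(t)=\widetilde\ast_t\widetilde\varphi(t)$ solves the Laplacian LCP-coflow $$\frac{d}{dt}\widetilde\psi(t)=-\widetilde\Delta_t\widetilde\psi(t),\qquad \widetilde\ast_t\widetilde\psi(t)\ \text{locally conformal parallel for every }t.$$
   Context: Notation: $e^{i_1\dots i_k}=e^{i_1}\wedge\dots\wedge e^{i_k}$, and similarly for $x^i$, $\widetilde x^i$. A Lie algebra is described by the tuple $(de^1,\dots,de^7)$ of exterior derivatives of a basis of its dual: \begin{align*} \mathfrak{cp}^m_1 &= (-me^{17}, -m e^{27}, -me^{37}, -m e^{47}, -me^{57}, -m e^{67}, 0);\\ \mathfrak{cp}^m_2 &= \big(-\tfrac43m e^{17}+\tfrac23me^{36}, -m e^{27}, -\tfrac23me^{37}, -m e^{47}, -me^{57}, -\tfrac23 m e^{67}, 0\big);\\ \mathfrak{cp}^m_3 &= \big(-\tfrac32m e^{17}+\tfrac12 m e^{36}+\tfrac12 m e^{45}, -m e^{27}, -\tfrac34me^{37}, -\tfrac34 m e^{47}, -\tfrac34me^{57}, -\tfrac34m e^{67}, 0\big);\\ \mathfrak{cp}^m_4 &= \big(-\tfrac75m e^{17}+\tfrac25 m e^{36}+\tfrac25 m e^{45}, -\tfrac65m e^{27}-\tfrac25m e^{46}, -\tfrac45me^{37},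 -\tfrac35 m e^{47}, -\tfrac45me^{57},-\tfrac35m e^{67}, 0\big);\\ \mathfrak{cp}^m_5 &= \big(-\tfrac54 m e^{17}+\tfrac12 m e^{45}, -\tfrac54m e^{27}-\tfrac12m e^{46}, -me^{37}, -\tfrac12 m e^{47}, -\tfrac34me^{57}, -\tfrac34m e^{67}, 0\big);\\ \mathfrak{cp}^m_6 &= \big(-\tfrac43m e^{17}+\tfrac13 m e^{36}+\tfrac13 m e^{45}, -\tfrac43m e^{27}+\tfrac13m e^{35}-\tfrac13 m e^{46}, -\tfrac23me^{37}, -\tfrac23 m e^{47}, -\tfrac23me^{57}, -\tfrac23m e^{67}, 0\big);\\ \mathfrak{cp}^m_7 &= \big(-\tfrac65m e^{17}+\tfrac25 m e^{36}, -\tfrac35m e^{27}, -\tfrac35me^{37}, \tfrac25 m e^{26}-\tfrac65 m e^{47}, \tfrac25 m e^{23}-\tfrac65me^{57}, -\tfrac35m e^{67}, 0\big). \end{align*} A $\mathrm{G}_2$-structure on a $7$-manifold is given by a $3$-form $\varphi$ which, with respect to some local basis of $1$-forms $\{x^1,\dots,x^7\}$ (an adapted basis), is $\varphi=x^{127}+x^{347}+x^{567}+x^{135}-x^{146}-x^{236}-x^{245}$. It induces the Riemannian metric $g_\varphi$ and the orientation for which $\{x^1,\dots,x^7\}$ is an oriented orthonormal coframe. $\Delta_t$ and $\ast_t$ (resp. $\widetilde\Delta_t$ and $\widetilde\ast_t$) denote the Hodge Laplacian $dd^{*}+d^{*}d$ and the Hodge star of the metric and orientation induced by $\varphi(t)$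 (resp. $\widetilde\varphi(t)$). A $\mathrm{G}_2$-structure $\varphi$ is locally conformal parallel (LCP, class $\mathcal{X}_4$) if there is a $1$-form $\tau$ (the Lee form) with $d\varphi=3\,\tau\wedge\varphi$ and $d{\ast}\varphi=4\,\tau\wedge{\ast}\varphi$. *)

theory Defs
  imports "HOL-Analysis.Analysis" "HOL-Algebra.Solvable_Groups"
begin

section \<open>Exterior algebra of a real vector space\<close>

text \<open>An element of the exterior algebra of the dual of \<open>'v\<close> is a function on lists of vectors;
  its component of degree \<open>k\<close> is its restriction to lists of length \<open>k\<close>. A form of degree \<open>k\<close>
  vanishes on the lists of any other length.\<close>

type_synonym 'v ext_form = "'v list \<Rightarrow> real"

definition alternating_form :: "nat \<Rightarrow> 'v::real_vector ext_form \<Rightarrow> bool" where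
  "alternating_form k \<omega> \<longleftrightarrow>
     (\<forall>vs. length vs \<noteq> k \<longrightarrow> \<omega> vs = 0) \<and>
     (\<forall>vs i. length vs = k \<and> i < k \<longrightarrow> linear (\<lambda>v. \<omega> (vs[i := v]))) \<and>
     (\<forall>vs. length vs = k \<and> \<not> distinct vs \<longrightarrow> \<omega> vs = 0)"

text \<open>The sum over shuffles, normalised such that the wedge product of two covectors maps
  \<open>[v, w]\<close> to \<open>\<alpha> [v] * \<beta> [w] - \<alpha> [w] * \<beta> [v]\<close>. The set \<open>P\<close> contains the positions of the
  arguments given to \<open>\<alpha>\<close>; the exponent counts the inversions of the shuffle.\<close>

definition wedge :: "'v ext_form \<Rightarrow> 'v ext_form \<Rightarrow> 'v ext_form"  (infixr \<open>\<^bold>\<and>\<close> 70) where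
  "(\<alpha> \<^bold>\<and> \<beta>) vs =
     (\<Sum>P \<in> Pow {..<length vs}.
        (-1) ^ card {(i, j). i \<in> P \<and> j \<in> {..<length vs} - P \<and> j < i}
        * \<alpha> (nths vs P) * \<beta> (nths vs ({..<length vs} - P)))"

text \<open>A basis of the dual of \<open>\<real>\<^sup>7\<close> is indexed by \<open>{1..7}\<close>.\<close>

definition coframe :: "(nat \<Rightarrow> (real^7) ext_form) \<Rightarrow> bool" where
  "coframe x \<longleftrightarrow>
     (\<forall>i\<in>{1..7}. alternating_form 1 (x i)) \<and>
     (\<forall>a :: nat \<Rightarrow> real.
        (\<forall>v. (\<Sum>i=1..7. a i * x i [v]) = 0) \<longrightarrow> (\<forall>i\<in>{1..7}. a i = 0))"

definition dual_vector :: "(nat \<Rightarrow> (real^7) ext_form) \<Rightarrow> nat \<Rightarrow> real^7" where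
  "dual_vector x j = (THE v. \<forall>i\<in>{1..7}. x i [v] = (if i = j then 1 else 0))"

definition dual_vectors :: "(nat \<Rightarrow> (real^7) ext_form) \<Rightarrow> nat set \<Rightarrow> (real^7) list" where
  "dual_vectors x I = map (dual_vector x) (sorted_list_of_set I)"

definition volume_form :: "(nat \<Rightarrow> (real^7) ext_form) \<Rightarrow> (real^7) ext_form" where
  "volume_form x = x 1 \<^bold>\<and> x 2 \<^bold>\<and> x 3 \<^bold>\<and> x 4 \<^bold>\<and> x 5 \<^bold>\<and> x 6 \<^bold>\<and> x 7"

text \<open>The Hodge star of the metric and orientation for which \<open>x\<close> is an oriented orthonormal
  coframe. For complementary \<open>I\<close> and \<open>J\<close> the value of the volume form on the dual vectors of \<open>I\<close>
  followed by those of \<open>J\<close> is the sign of that rearrangement, so this maps the basis element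
  \<open>x\<^sup>I\<close> to that sign times \<open>x\<^sup>J\<close>, that is,
  \<open>\<alpha> \<^bold>\<and> hodge x \<beta> = \<langle>\<alpha>, \<beta>\<rangle> volume_form x\<close>.\<close>

definition hodge :: "(nat \<Rightarrow> (real^7) ext_form) \<Rightarrow> (real^7) ext_form \<Rightarrow> (real^7) ext_form" where
  "hodge x \<omega> vs =
     (\<Sum>I | I \<subseteq> {1..7} \<and> card I + length vs = 7.
        \<omega> (dual_vectors x I) * volume_form x (dual_vectors x I @ vs))"

definition g2_form :: "(nat \<Rightarrow> (real^7) ext_form) \<Rightarrow> (real^7) ext_form" where
  "g2_form x vs =
     (x 1 \<^bold>\<and> x 2 \<^bold>\<and> x 7) vs + (x 3 \<^bold>\<and> x 4 \<^bold>\<and> x 7) vs + (x 5 \<^bold>\<and> x 6 \<^bold>\<and> x 7) vs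
     + (x 1 \<^bold>\<and> x 3 \<^bold>\<and> x 5) vs - (x 1 \<^bold>\<and> x 4 \<^bold>\<and> x 6) vs
     - (x 2 \<^bold>\<and> x 3 \<^bold>\<and> x 6) vs - (x 2 \<^bold>\<and> x 4 \<^bold>\<and> x 5) vs"


section \<open>Smooth manifolds of dimension 7 and Lie groups\<close>

primrec Ck_on :: "nat \<Rightarrow> 'a::real_normed_vector set \<Rightarrow> ('a \<Rightarrow> 'b::real_normed_vector) \<Rightarrow> bool" where
  "Ck_on 0 U f = continuous_on U f"
| "Ck_on (Suc k) U f =
     (\<exists>f'. (\<forall>x\<in>U. (f has_derivative f' x) (at x)) \<and> (\<forall>v. Ck_on k U (\<lambda>x. f' x v)))"

definition Cinf_on :: "'a::real_normed_vector set \<Rightarrow> ('a \<Rightarrow> 'b::real_normed_vector) \<Rightarrow> bool" where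
  "Cinf_on U f \<longleftrightarrow> (\<forall>k. Ck_on k U f)"

text \<open>A chart is an open set together with a coordinate map on it.\<close>

type_synonym 's chart = "'s set \<times> ('s \<Rightarrow> real^7)"

abbreviation chart_image :: "'s chart \<Rightarrow> (real^7) set" where
  "chart_image c \<equiv> snd c ` fst c"

definition chart_inv :: "'s chart \<Rightarrow> real^7 \<Rightarrow> 's" where
  "chart_inv c = inv_into (fst c) (snd c)"

definition is_chart :: "'s topology \<Rightarrow> 's chart \<Rightarrow> bool" where
  "is_chart T c \<longleftrightarrow> openin T (fst c) \<and> open (chart_image c) \<and>
     homeomorphic_map (subtopology T (fst c)) (top_of_set (chart_image c)) (snd c)"

definition coord_domain :: "('s \<Rightarrow> 's) \<Rightarrow> 's chart \<Rightarrow> 's chart \<Rightarrow> (real^7) set" where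
  "coord_domain f c c' = {y \<in> chart_image c. f (chart_inv c y) \<in> fst c'}"

definition coord_rep :: "('s \<Rightarrow> 's) \<Rightarrow> 's chart \<Rightarrow> 's chart \<Rightarrow> real^7 \<Rightarrow> real^7" where
  "coord_rep f c c' y = snd c' (f (chart_inv c y))"

definition smooth_self_map :: "'s topology \<Rightarrow> 's chart set \<Rightarrow> ('s \<Rightarrow> 's) \<Rightarrow> bool" where
  "smooth_self_map T A f \<longleftrightarrow> continuous_map T T f \<and>
     (\<forall>c\<in>A. \<forall>c'\<in>A. Cinf_on (coord_domain f c c') (coord_rep f c c'))"

text \<open>With \<open>f = id\<close>, smoothness of \<open>f\<close> is smoothness of the transition maps.\<close>

definition smooth_manifold :: "'s topology \<Rightarrow> 's chart set \<Rightarrow> bool" where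
  "smooth_manifold T A \<longleftrightarrow> Hausdorff_space T \<and> second_countable T \<and>
     (\<forall>c\<in>A. is_chart T c) \<and> (\<Union>c\<in>A. fst c) = topspace T \<and> smooth_self_map T A id"

definition smooth_operation ::
    "'s topology \<Rightarrow> 's chart set \<Rightarrow> ('s \<Rightarrow> 's \<Rightarrow> 's) \<Rightarrow> bool" where
  "smooth_operation T A f \<longleftrightarrow> continuous_map (prod_topology T T) T (\<lambda>(g, h). f g h) \<and>
     (\<forall>c1\<in>A. \<forall>c2\<in>A. \<forall>c3\<in>A.
        Cinf_on {(y, z). y \<in> chart_image c1 \<and> z \<in> chart_image c2 \<and>
                         f (chart_inv c1 y) (chart_inv c2 z) \<in> fst c3}
                (\<lambda>(y, z). snd c3 (f (chart_inv c1 y) (chart_inv c2 z))))"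

definition lie_group :: "('s, 'r) monoid_scheme \<Rightarrow> 's topology \<Rightarrow> 's chart set \<Rightarrow> bool" where
  "lie_group G T A \<longleftrightarrow> group G \<and> topspace T = carrier G \<and> smooth_manifold T A \<and>
     smooth_operation T A (mult G) \<and> smooth_self_map T A (m_inv G)"


section \<open>Differential forms\<close>

text \<open>A differential form is given by its representatives in the coordinates of all charts:
  \<open>\<omega> c y\<close> is the form at the point of the chart \<open>c\<close> with coordinates \<open>y \<in> chart_image c\<close>. The
  values at other \<open>c\<close> and \<open>y\<close> are irrelevant.\<close>

type_synonym 's dform = "'s chart \<Rightarrow> real^7 \<Rightarrow> (real^7) ext_form"

definition form_eq :: "'s chart set \<Rightarrow> 's dform \<Rightarrow> 's dform \<Rightarrow> bool" where
  "form_eq A \<alpha> \<beta> \<longleftrightarrow> (\<forall>c\<in>A. \<forall>y\<in>chart_image c. \<alpha> c y = \<beta> c y)"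

text \<open>The pullback of \<open>\<omega>\<close> along \<open>f\<close> is \<open>\<omega>\<close>.\<close>

definition pullback_invariant :: "'s chart set \<Rightarrow> ('s \<Rightarrow> 's) \<Rightarrow> 's dform \<Rightarrow> bool" where
  "pullback_invariant A f \<omega> \<longleftrightarrow>
     (\<forall>c\<in>A. \<forall>c'\<in>A. \<forall>y\<in>coord_domain f c c'. \<forall>vs.
        \<omega> c y vs =
        \<omega> c' (coord_rep f c c' y) (map (frechet_derivative (coord_rep f c c') (at y)) vs))"

text \<open>Invariance under \<open>id\<close> says that the representatives in overlapping charts agree.\<close>

definition diff_form :: "'s chart set \<Rightarrow> nat \<Rightarrow> 's dform \<Rightarrow> bool" where
  "diff_form A k \<omega> \<longleftrightarrow>
     (\<forall>c\<in>A. \<forall>y\<in>chart_image c. alternating_form k (\<omega> c y)) \<and>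
     (\<forall>c\<in>A. \<forall>vs. Cinf_on (chart_image c) (\<lambda>y. \<omega> c y vs)) \<and>
     pullback_invariant A id \<omega>"

definition left_invariant ::
    "('s, 'r) monoid_scheme \<Rightarrow> 's chart set \<Rightarrow> 's dform \<Rightarrow> bool" where
  "left_invariant G A \<omega> \<longleftrightarrow> (\<forall>g\<in>carrier G. pullback_invariant A (mult G g) \<omega>)"

definition wedge_form :: "'s dform \<Rightarrow> 's dform \<Rightarrow> 's dform" where
  "wedge_form \<alpha> \<beta> c y = \<alpha> c y \<^bold>\<and> \<beta> c y"

definition scale_form :: "real \<Rightarrow> 's dform \<Rightarrow> 's dform" where
  "scale_form a \<omega> c y vs = a * \<omega> c y vs"

definition ext_deriv :: "'s dform \<Rightarrow> 's dform" where
  "ext_deriv \<omega> c y vs =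
     (\<Sum>i<length vs. (-1) ^ i *
        frechet_derivative (\<lambda>z. \<omega> c z (take i vs @ drop (Suc i) vs)) (at y) (vs ! i))"

text \<open>In the following operators \<open>x\<close> consists of 1-forms \<open>x 1, ..., x 7\<close>, and the metric and the
  orientation are those for which they are an oriented orthonormal coframe.\<close>

definition star :: "(nat \<Rightarrow> 's dform) \<Rightarrow> 's dform \<Rightarrow> 's dform" where
  "star x \<omega> c y = hodge (\<lambda>i. x i c y) (\<omega> c y)"

text \<open>In dimension 7, \<open>d\<^sup>* = (-1)\<^sup>k * d *\<close> on forms of degree \<open>k\<close>, whose images have degree
  \<open>k - 1\<close>.\<close>

definition codiff :: "(nat \<Rightarrow> 's dform) \<Rightarrow> 's dform \<Rightarrow> 's dform" where
  "codiff x \<omega> c y vs = (-1) ^ (length vs + 1) * star x (ext_deriv (star x \<omega>)) c y vs"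

definition hodge_laplacian :: "(nat \<Rightarrow> 's dform) \<Rightarrow> 's dform \<Rightarrow> 's dform" where
  "hodge_laplacian x \<omega> c y vs =
     ext_deriv (codiff x \<omega>) c y vs + codiff x (ext_deriv \<omega>) c y vs"


section \<open>The Lie algebras\<close>

text \<open>The \<open>i\<close>-th entry of the list contains a triple \<open>(a, j, k)\<close> for each summand
  \<open>a e\<^sup>j\<^sup>k\<close> of \<open>de\<^sup>i\<close>.\<close>

definition structure_equations ::
    "'s chart set \<Rightarrow> (real \<times> nat \<times> nat) list list \<Rightarrow> (nat \<Rightarrow> 's dform) \<Rightarrow> bool" where
  "structure_equations A L e \<longleftrightarrow>
     (\<forall>i\<in>{1..7}. form_eq A (ext_deriv (e i))
        (\<lambda>c y vs. \<Sum>(a, j, k)\<leftarrow>L ! (i - 1). a * wedge_form (e j) (e k) c y vs))"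

definition cp :: "nat \<Rightarrow> real \<Rightarrow> (real \<times> nat \<times> nat) list list" where
  "cp s m =
    [[[(-m, 1, 7)], [(-m, 2, 7)], [(-m, 3, 7)], [(-m, 4, 7)], [(-m, 5, 7)], [(-m, 6, 7)], []],

     [[(-4/3*m, 1, 7), (2/3*m, 3, 6)], [(-m, 2, 7)], [(-2/3*m, 3, 7)], [(-m, 4, 7)],
      [(-m, 5, 7)], [(-2/3*m, 6, 7)], []],

     [[(-3/2*m, 1, 7), (1/2*m, 3, 6), (1/2*m, 4, 5)], [(-m, 2, 7)], [(-3/4*m, 3, 7)],
      [(-3/4*m, 4, 7)], [(-3/4*m, 5, 7)], [(-3/4*m, 6, 7)], []],

     [[(-7/5*m, 1, 7), (2/5*m, 3, 6), (2/5*m, 4, 5)], [(-6/5*m, 2, 7), (-2/5*m, 4, 6)],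
      [(-4/5*m, 3, 7)], [(-3/5*m, 4, 7)], [(-4/5*m, 5, 7)], [(-3/5*m, 6, 7)], []],

     [[(-5/4*m, 1, 7), (1/2*m, 4, 5)], [(-5/4*m, 2, 7), (-1/2*m, 4, 6)],
      [(-m, 3, 7)], [(-1/2*m, 4, 7)], [(-3/4*m, 5, 7)], [(-3/4*m, 6, 7)], []],

     [[(-4/3*m, 1, 7), (1/3*m, 3, 6), (1/3*m, 4, 5)],
      [(-4/3*m, 2, 7), (1/3*m, 3, 5), (-1/3*m, 4, 6)],
      [(-2/3*m, 3, 7)], [(-2/3*m, 4, 7)], [(-2/3*m, 5, 7)], [(-2/3*m, 6, 7)], []],

     [[(-6/5*m, 1, 7), (2/5*m, 3, 6)], [(-3/5*m, 2, 7)], [(-3/5*m, 3, 7)],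
      [(2/5*m, 2, 6), (-6/5*m, 4, 7)], [(2/5*m, 2, 3), (-6/5*m, 5, 7)],
      [(-3/5*m, 6, 7)], []]] ! (s - 1)"

definition left_invariant_basis ::
    "('s, 'r) monoid_scheme \<Rightarrow> 's chart set \<Rightarrow> (nat \<Rightarrow> 's dform) \<Rightarrow> bool" where
  "left_invariant_basis G A e \<longleftrightarrow>
     (\<forall>i\<in>{1..7}. diff_form A 1 (e i) \<and> left_invariant G A (e i)) \<and>
     (\<forall>c\<in>A. \<forall>y\<in>chart_image c. coframe (\<lambda>i. e i c y))"


section \<open>G2-structures and flows\<close>

definition g2_structure :: "(nat \<Rightarrow> 's dform) \<Rightarrow> 's dform" where
  "g2_structure x c y = g2_form (\<lambda>i. x i c y)"

text \<open>Here \<open>\<psi>\<close> is the Hodge dual of \<open>\<phi>\<close>, the Hodge star being taken at each point with respect to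
  an adapted basis of \<open>\<phi>\<close> there. It does not depend on the choice of that basis, as the
  stabiliser of \<open>\<phi>\<close> is contained in the rotation group.\<close>

definition lcp :: "'s chart set \<Rightarrow> 's dform \<Rightarrow> bool" where
  "lcp A \<phi> \<longleftrightarrow> diff_form A 3 \<phi> \<and>
     (\<exists>\<psi> \<tau>. diff_form A 4 \<psi> \<and> diff_form A 1 \<tau> \<and>
        (\<forall>c\<in>A. \<forall>y\<in>chart_image c. \<exists>x. coframe x \<and> \<phi> c y = g2_form x \<and> \<psi> c y = hodge x (\<phi> c y)) \<and>
        form_eq A (ext_deriv \<phi>) (scale_form 3 (wedge_form \<tau> \<phi>)) \<and>
        form_eq A (ext_deriv \<psi>) (scale_form 4 (wedge_form \<tau> \<psi>)))"

definition form_deriv_at ::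
    "'s chart set \<Rightarrow> (real \<Rightarrow> 's dform) \<Rightarrow> 's dform \<Rightarrow> real \<Rightarrow> bool" where
  "form_deriv_at A \<omega> \<omega>' t \<longleftrightarrow>
     (\<forall>c\<in>A. \<forall>y\<in>chart_image c. \<forall>vs. ((\<lambda>r. \<omega> r c y vs) has_real_derivative \<omega>' c y vs) (at t))"

text \<open>In both flows \<open>x t\<close> is an adapted coframe of the G2-structure at time \<open>t\<close>.\<close>

definition laplacian_lcp_flow ::
    "'s chart set \<Rightarrow> real set \<Rightarrow> (real \<Rightarrow> nat \<Rightarrow> 's dform) \<Rightarrow> (real \<Rightarrow> 's dform) \<Rightarrow> bool" where
  "laplacian_lcp_flow A J x \<phi> \<longleftrightarrow>
     (\<forall>t\<in>J. form_deriv_at A \<phi> (hodge_laplacian (x t) (\<phi> t)) t \<and> lcp A (\<phi> t))"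

definition laplacian_lcp_coflow ::
    "'s chart set \<Rightarrow> real set \<Rightarrow> (real \<Rightarrow> nat \<Rightarrow> 's dform) \<Rightarrow> (real \<Rightarrow> 's dform) \<Rightarrow> bool" where
  "laplacian_lcp_coflow A J x \<psi> \<longleftrightarrow>
     (\<forall>t\<in>J. form_deriv_at A \<psi> (scale_form (-1) (hodge_laplacian (x t) (\<psi> t))) t \<and>
            lcp A (star (x t) (\<psi> t)))"

definition power_domain :: "real \<Rightarrow> real \<Rightarrow> real set" where
  "power_domain m a = {t. 1 - a * m\<^sup>2 * t > 0}"

definition power_coframe ::
    "real \<Rightarrow> real \<Rightarrow> (nat \<Rightarrow> real) \<Rightarrow> (nat \<Rightarrow> 's dform) \<Rightarrow> real \<Rightarrow> nat \<Rightarrow> 's dform" where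
  "power_coframe m a b e t i = scale_form ((1 - a * m\<^sup>2 * t) powr b i) (e i)"

definition power_g2 ::
    "real \<Rightarrow> real \<Rightarrow> (nat \<Rightarrow> real) \<Rightarrow> (nat \<Rightarrow> 's dform) \<Rightarrow> real \<Rightarrow> 's dform" where
  "power_g2 m a b e t = g2_structure (power_coframe m a b e t)"

end

(* The two families are homothetic. With B = beta_1 + ... + beta_7 and kappa = 2 / (2 - B), the relations
   say delta_i - 1/2 = kappa (beta_i - 1/2) and alpha = kappa gamma. Hence at times t, t' with
   u = 1 - alpha m^2 t, v = 1 - gamma m^2 t' and u = v^kappa the second adapted coframe is r times the
   first, where r^2 = v / u, and matching times exhaust both domains. A homothety preserves the Lee form,
   which gives (i). For (ii), the Hodge star commutes with the Laplacian, so the coflow is an equation for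
   the Laplacian of the 3-form. The time derivative of the 3-form multiplies its x^I-term by
   -(alpha m^2 / u) beta_I, that of the dual 4-form multiplies the star of that term by
   -(gamma m^2 / v) (delta_1 + ... + delta_7 - delta_I), and the latter factor equals (alpha m^2 / v) beta_I;
   with the scaling of the Laplacian by r^-2 the two equations are the same. *)
theory Submission
  imports Defs
begin

section \<open>Alternating forms\<close>

text \<open>A form is a function on lists of vectors of every length, and \<open>ext_deriv\<close>
  is assembled from \<open>frechet_derivative\<close>, which obeys the expected algebra only for
  differentiable functions. So each operator comes with a proof that it preserves alternation and
  smoothness before an identity about it can be applied to the result of another operator. The
  delicate operator is the Hodge star, defined through dual vectors that are chosen with THE:
  Cramer's rule exhibits them as quotients of determinants.

  The number 2 - B enters because a term of the 3-form has three indices and its dual has four. With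
  \<delta>_l = 1/2 + \<kappa> (\<beta>_l - 1/2), the four complementary exponents add up to 2 +
  \<kappa> (B - 2 - \<beta>_I), and \<kappa> is exactly the value for which the constants cancel and
  - \<kappa> \<beta>_I is left. This is why the dual family, run with the opposite sign of the
  Laplacian, reproduces the logarithmic derivatives of the original 3-form.\<close>

lemma linear_times:
  fixes f :: "'v::real_vector \<Rightarrow> real"
  shows "linear f \<Longrightarrow> linear (\<lambda>v. r * f v)"
  using linear_compose_scale_right[of f r] by simp

lemma alternating_form_length:
  "alternating_form k \<omega> \<Longrightarrow> length vs \<noteq> k \<Longrightarrow> \<omega> vs = 0"
  by (simp add: alternating_form_def)

lemma alternating_form_not_distinct:
  assumes "alternating_form k \<omega>" "\<not> distinct vs"
  shows "\<omega> vs = 0"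
  using assms by (cases "length vs = k") (auto simp: alternating_form_def)

lemma alternating_form_linear:
  assumes "alternating_form k \<omega>"
  shows "linear (\<lambda>v. \<omega> (a @ v # b))"
proof (cases "Suc (length a + length b) = k")
  case True
  have "linear (\<lambda>v. \<omega> ((a @ 0 # b)[length a := v]))"
    using assms True unfolding alternating_form_def
    by (elim conjE allE[of _ "a @ 0 # b"] allE[of _ "length a"]) auto
  then show ?thesis by simp
next
  case False
  then have "\<omega> (a @ v # b) = 0" for v
    using assms by (intro alternating_form_length) auto
  then show ?thesis by (simp add: linear_iff)
qed

lemma alternating_formI:
  assumes "\<And>vs. length vs \<noteq> k \<Longrightarrow> \<omega> vs = 0"
    and "\<And>a b. linear (\<lambda>v. \<omega> (a @ v # b))"
    and "\<And>vs. length vs = k \<Longrightarrow> \<not> distinct vs \<Longrightarrow> \<omega> vs = 0"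
  shows "alternating_form k \<omega>"
  unfolding alternating_form_def
proof (intro conjI allI impI)
  fix vs :: "'a list" and i
  assume "length vs = k \<and> i < k"
  then have "vs[i := v] = take i vs @ v # drop (Suc i) vs" for v
    by (simp add: upd_conv_take_nth_drop)
  then show "linear (\<lambda>v. \<omega> (vs[i := v]))" using assms(2) by simp
qed (use assms in auto)

lemma alternating_form_scale:
  assumes "alternating_form k \<omega>"
  shows "alternating_form k (\<lambda>vs. r * \<omega> vs)"
  using assms by (auto simp: alternating_form_def intro!: linear_times)

lemma alternating_form_add:
  assumes "alternating_form k \<omega>" "alternating_form k \<eta>"
  shows "alternating_form k (\<lambda>vs. \<omega> vs + \<eta> vs)"
  using assms by (auto simp: alternating_form_def intro!: linear_compose_add)

text \<open>Polarisation: the form vanishes when both adjacent arguments are \<open>v + w\<close>,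
  and of the four terms of the expansion only the two mixed ones survive.\<close>

lemma alternating_form_swap:
  assumes "alternating_form k \<omega>"
  shows "\<omega> (a @ v # w # b) = - \<omega> (a @ w # v # b)"
proof -
  have l1: "linear (\<lambda>v. \<omega> (a @ v # w # b))" for w
    by (rule alternating_form_linear[OF assms])
  have l2: "linear (\<lambda>w. \<omega> (a @ v # w # b))" for v
    using alternating_form_linear[OF assms, of "a @ [v]"] by simp
  have z: "\<omega> (a @ v # v # b) = 0" for v
    by (rule alternating_form_not_distinct[OF assms]) simp
  have "0 = \<omega> (a @ (v + w) # (v + w) # b)" by (simp add: z)
  also have "\<dots> = \<omega> (a @ v # v # b) + \<omega> (a @ v # w # b) + (\<omega> (a @ w # v # b) + \<omega> (a @ w # w # b))"
    by (simp add: linear_add[OF l1] linear_add[OF l2])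
  finally show ?thesis by (simp add: z)
qed

lemma alternating_form_move:
  assumes "alternating_form k \<omega>"
  shows "\<omega> (a @ v # b @ c) = (-1) ^ length b * \<omega> (a @ b @ v # c)"
proof (induction b arbitrary: a)
  case (Cons w b)
  have "\<omega> (a @ v # (w # b) @ c) = - \<omega> ((a @ [w]) @ v # b @ c)"
    using alternating_form_swap[OF assms, of a v w "b @ c"] by simp
  then show ?case by (simp only: Cons.IH) simp
qed simp

text \<open>Each of the \<open>length xs\<close> vectors passes each of the \<open>length ys\<close>
  others. The parity of this product decides the sign of the double Hodge star.\<close>

lemma alternating_form_move_block:
  assumes "alternating_form k \<omega>"
  shows "\<omega> (a @ xs @ ys) = (-1) ^ (length xs * length ys) * \<omega> (a @ ys @ xs)"
proof (induction xs arbitrary: a)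
  case (Cons x xs)
  have "\<omega> (a @ (x # xs) @ ys) = (-1) ^ (length xs * length ys) * \<omega> (a @ x # ys @ xs)"
    using Cons.IH[of "a @ [x]"] by simp
  also have "\<omega> (a @ x # ys @ xs) = (-1) ^ length ys * \<omega> (a @ ys @ x # xs)"
    by (rule alternating_form_move[OF assms])
  finally show ?case by (simp add: power_add)
qed simp

text \<open>The absolute value hides the sign of the permutation, which therefore never has to be
  named; it is enough for detecting zeros and for showing that a value is 1 or -1.\<close>

lemma alternating_form_permute:
  assumes "alternating_form k \<omega>" "mset xs = mset ys"
  shows "\<bar>\<omega> xs\<bar> = \<bar>\<omega> ys\<bar>"
proof -
  \<comment> \<open>The prefix \<open>a\<close> absorbs the vectors that are already in place during
    the induction.\<close>
  have "\<bar>\<omega> (a @ xs)\<bar> = \<bar>\<omega> (a @ ys)\<bar>" for a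
    using assms(2)
  proof (induction xs arbitrary: a ys)
    case (Cons v xs)
    then have "v \<in> set ys" by (metis list.set_intros(1) set_mset_mset)
    then obtain p q where ys: "ys = p @ v # q" by (meson split_list)
    then have "mset xs = mset (p @ q)" using Cons.prems by simp
    then have "\<bar>\<omega> ((a @ [v]) @ xs)\<bar> = \<bar>\<omega> ((a @ [v]) @ p @ q)\<bar>" by (rule Cons.IH)
    also have "\<dots> = \<bar>\<omega> (a @ v # p @ q)\<bar>" by simp
    also have "\<dots> = \<bar>\<omega> (a @ ys)\<bar>"
      by (simp add: alternating_form_move[OF assms(1)] ys abs_mult)
    finally show ?case by simp
  qed simp
  from this[of "[]"] show ?thesis by simp
qed

text \<open>For alternating sums that omit one argument at a time: if two arguments coincide, only
  the summands that omit one of these two can be nonzero.\<close>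

lemma not_distinct_take_drop:
  assumes "p < q" "q < length vs" "vs ! p = vs ! q" "i < length vs" "i \<noteq> p" "i \<noteq> q"
  shows "\<not> distinct (take i vs @ drop (Suc i) vs)"
proof -
  define ws where "ws = take i vs @ drop (Suc i) vs"
  have len: "length ws = length vs - 1" using assms by (simp add: ws_def)
  have nth: "ws ! j = vs ! (if j < i then j else Suc j)" if "j < length ws" for j
    using that assms by (auto simp: ws_def nth_append min_def)
  define p' q' where "p' = (if p < i then p else p - 1)" and "q' = (if q < i then q else q - 1)"
  have *: "p' < length ws" "q' < length ws" "p' \<noteq> q'"
    using assms len by (auto simp: p'_def q'_def split: if_splits)
  have "ws ! p' = vs ! p" "ws ! q' = vs ! q"
    using nth[OF *(1)] nth[OF *(2)] assms by (auto simp: p'_def q'_def split: if_splits)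
  then have "\<not> distinct ws" using * assms(3) by (metis nth_eq_iff_index_eq)
  then show ?thesis by (simp add: ws_def)
qed

text \<open>The instances \<open>F v ws = \<alpha> [v] * \<beta> ws\<close> and \<open>F v ws = D\<^sub>v (\<omega> ws)\<close> give the wedge product with
  a covector and the exterior derivative.\<close>

lemma alternating_form_alternation:
  fixes F :: "'v::real_vector \<Rightarrow> 'v ext_form"
  assumes F: "\<And>v. alternating_form k (F v)" and lin: "\<And>ws. linear (\<lambda>v. F v ws)"
  shows "alternating_form (Suc k)
    (\<lambda>vs. \<Sum>i<length vs. (-1) ^ i * F (vs ! i) (take i vs @ drop (Suc i) vs))"
proof (rule alternating_formI)
  fix vs :: "'v list"
  assume "length vs \<noteq> Suc k"
  then have "length (take i vs @ drop (Suc i) vs) \<noteq> k" if "i < length vs" for i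
    using that by auto
  then show "(\<Sum>i<length vs. (-1) ^ i * F (vs ! i) (take i vs @ drop (Suc i) vs)) = 0"
    by (intro sum.neutral ballI) (simp add: alternating_form_length[OF F])
next
  fix a b :: "'v list"
  have "linear (\<lambda>v. (-1) ^ i * F ((a @ v # b) ! i)
      (take i (a @ v # b) @ drop (Suc i) (a @ v # b)))" (is "linear ?f") for i
  proof (rule linear_times)
    \<comment> \<open>The free argument \<open>v\<close> stays in the list, after or before the
      omitted position, or it is itself the omitted one and fills the slot of \<open>F\<close>. The
      two linearity assumptions cover these cases.\<close>
    consider "i < length a" | "i = length a" | j where "i = Suc (length a + j)"
      by (metis add_Suc_right less_imp_Suc_add linorder_neqE_nat)
    then show "linear (\<lambda>v. F ((a @ v # b) ! i)
        (take i (a @ v # b) @ drop (Suc i) (a @ v # b)))"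
    proof cases
      case 1
      then show ?thesis
        using alternating_form_linear[OF F, of "a ! i" "take i a @ drop (Suc i) a" b]
        by (simp add: nth_append)
    next
      case 2
      then show ?thesis using lin[of "a @ b"] by simp
    next
      case 3
      then show ?thesis
        using alternating_form_linear[OF F, of "b ! j" a "take j b @ drop (Suc j) b"]
        by (simp add: nth_append)
    qed
  qed
  then show "linear (\<lambda>v. \<Sum>i<length (a @ v # b). (-1) ^ i * F ((a @ v # b) ! i)
      (take i (a @ v # b) @ drop (Suc i) (a @ v # b)))"
    by (simp only: length_append list.size) (rule linear_compose_sum, simp)
next
  fix vs :: "'v list"
  assume "\<not> distinct vs"
  then obtain a b c v where vs: "vs = a @ [v] @ b @ [v] @ c"
    using not_distinct_decomp by blast
  define p q where "p = length a" and "q = Suc (length a + length b)"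
  have pq: "p < q" "q < length vs" by (auto simp: p_def q_def vs)
  have vp: "vs ! p = v" "vs ! q = v" by (auto simp: p_def q_def vs nth_append)
  let ?g = "\<lambda>i. (-1) ^ i * F (vs ! i) (take i vs @ drop (Suc i) vs)"
  have "?g i = 0" if "i \<in> {..<length vs} - {p, q}" for i
    using not_distinct_take_drop[OF pq, of i] that vp
    by (simp add: alternating_form_not_distinct[OF F])
  then have "(\<Sum>i<length vs. ?g i) = (\<Sum>i\<in>{p, q}. ?g i)"
    using pq by (intro sum.mono_neutral_right) auto
  also have "\<dots> = ?g p + ?g q" using pq by simp
  also have "?g p = (-1) ^ length a * F v (a @ b @ v # c)"
    by (simp add: p_def vs)
  also have "?g q = (-1) ^ Suc (length a + length b) * F v (a @ v # b @ c)"
    by (simp add: q_def vs nth_append)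
  \<comment> \<open>Moving the remaining copy of \<open>v\<close> across \<open>b\<close> costs
    (-1)^(length b), while the signs of the two summands differ by (-1)^(length b + 1), so they
    cancel.\<close>
  also have "F v (a @ v # b @ c) = (-1) ^ length b * F v (a @ b @ v # c)"
    by (rule alternating_form_move[OF F])
  finally show "(\<Sum>i<length vs. ?g i) = 0" by (simp add: power_add)
qed

section \<open>Wedge products with a covector\<close>

lemma nths_remove:
  assumes "i < length vs"
  shows "nths vs ({..<length vs} - {i}) = take i vs @ drop (Suc i) vs"
proof -
  have "nths vs ({..<length vs} - {i}) =
      nths (take i vs @ vs ! i # drop (Suc i) vs) ({..<length vs} - {i})"
    using assms by (simp add: id_take_nth_drop[symmetric])
  also have "\<dots> = take i vs @ drop (Suc i) vs"
    using assms by (auto simp: nths_append nths_Cons intro!: arg_cong2[where f = append] nths_all)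
  finally show ?thesis .
qed

lemma nths_singleton_index:
  assumes "i < length vs"
  shows "nths vs {i} = [vs ! i]"
proof -
  have "nths vs {i} = nths (take i vs @ vs ! i # drop (Suc i) vs) {i}"
    using assms by (simp add: id_take_nth_drop[symmetric])
  also have "\<dots> = [vs ! i]"
    using assms by (auto simp: nths_append nths_Cons set_nths simp flip: set_empty)
  finally show ?thesis .
qed

text \<open>The factor \<alpha> vanishes on lists whose length is not 1, so only singleton sets
  \<open>P = {i}\<close> contribute to the sum over shuffles, and such a shuffle has
  \<open>i\<close> inversions.\<close>

lemma wedge_covector:
  assumes "alternating_form 1 \<alpha>"
  shows "(\<alpha> \<^bold>\<and> \<beta>) vs =
    (\<Sum>i<length vs. (-1) ^ i * (\<alpha> [vs ! i] * \<beta> (take i vs @ drop (Suc i) vs)))"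
proof -
  let ?N = "{..<length vs}"
  let ?g = "\<lambda>P. (-1) ^ card {(i, j). i \<in> P \<and> j \<in> ?N - P \<and> j < i}
        * \<alpha> (nths vs P) * \<beta> (nths vs (?N - P))"
  have "?g P = 0" if "P \<in> Pow ?N - (\<lambda>i. {i}) ` ?N" for P
  proof -
    have "card P \<noteq> 1" using that by (auto simp: card_1_singleton_iff)
    moreover have "{i. i < length vs \<and> i \<in> P} = P" using that by auto
    ultimately have "length (nths vs P) \<noteq> 1" by (simp add: length_nths)
    then show ?thesis using alternating_form_length[OF assms] by simp
  qed
  then have "(\<alpha> \<^bold>\<and> \<beta>) vs = (\<Sum>P\<in>(\<lambda>i. {i}) ` ?N. ?g P)"
    unfolding wedge_def by (intro sum.mono_neutral_right) auto
  also have "\<dots> = (\<Sum>i\<in>?N. ?g {i})"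
    by (subst sum.reindex) auto
  also have "\<dots> = (\<Sum>i<length vs. (-1) ^ i * (\<alpha> [vs ! i] * \<beta> (take i vs @ drop (Suc i) vs)))"
  proof (intro sum.cong refl)
    fix i assume i: "i \<in> ?N"
    then have "{(i', j). i' \<in> {i} \<and> j \<in> ?N - {i} \<and> j < i'} = Pair i ` {..<i}"
      by auto
    then have "card {(i', j). i' \<in> {i} \<and> j \<in> ?N - {i} \<and> j < i'} = i"
      by (simp add: card_image inj_on_def)
    then show "?g {i} = (-1) ^ i * (\<alpha> [vs ! i] * \<beta> (take i vs @ drop (Suc i) vs))"
      using i by (simp add: nths_remove nths_singleton_index)
  qed
  finally show ?thesis .
qed

lemma alternating_form_wedge:
  assumes "alternating_form 1 \<alpha>" "alternating_form k \<beta>"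
  shows "alternating_form (Suc k) (\<alpha> \<^bold>\<and> \<beta>)"
proof -
  have "alternating_form k (\<lambda>ws. \<alpha> [v] * \<beta> ws)" for v
    by (rule alternating_form_scale[OF assms(2)])
  moreover have "linear (\<lambda>v. \<alpha> [v] * \<beta> ws)" for ws
    using linear_times[OF alternating_form_linear[OF assms(1), of "[]" "[]"], of "\<beta> ws"]
    by (simp add: mult.commute)
  ultimately show ?thesis
    using alternating_form_alternation[of k "\<lambda>v ws. \<alpha> [v] * \<beta> ws"]
    by (simp add: wedge_covector[OF assms(1), abs_def])
qed

text \<open>Only the summand with \<open>i = 0\<close> survives, as all others evaluate \<alpha> on
  a member of \<open>ws\<close>. This evaluates the volume form on the dual basis one factor at a
  time.\<close>

lemma wedge_covector_Cons:
  assumes "alternating_form 1 \<alpha>" "\<alpha> [v] = 1" "\<forall>w\<in>set ws. \<alpha> [w] = 0"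
  shows "(\<alpha> \<^bold>\<and> \<beta>) (v # ws) = \<beta> ws"
  using assms(2,3) by (simp add: wedge_covector[OF assms(1)] sum.lessThan_Suc_shift del: sum.lessThan_Suc)

text \<open>Serves to locate the support of a product of three covectors, by peeling off one factor
  after the other.\<close>

lemma wedge_covector_nonzero:
  assumes "alternating_form 1 \<alpha>" "(\<alpha> \<^bold>\<and> \<beta>) vs \<noteq> 0"
  shows "\<exists>v\<in>set vs. \<alpha> [v] \<noteq> 0" "\<exists>ws. set ws \<subseteq> set vs \<and> \<beta> ws \<noteq> 0"
proof -
  obtain i where "i \<in> {..<length vs}"
    "(-1) ^ i * (\<alpha> [vs ! i] * \<beta> (take i vs @ drop (Suc i) vs)) \<noteq> 0"
    using assms(2) unfolding wedge_covector[OF assms(1)]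
    by (rule sum.not_neutral_contains_not_neutral)
  then have i: "i < length vs" "\<alpha> [vs ! i] \<noteq> 0" "\<beta> (take i vs @ drop (Suc i) vs) \<noteq> 0"
    by auto
  then show "\<exists>v\<in>set vs. \<alpha> [v] \<noteq> 0" by (meson nth_mem)
  have "set (take i vs @ drop (Suc i) vs) \<subseteq> set vs"
    by (auto dest: in_set_takeD in_set_dropD)
  then show "\<exists>ws. set ws \<subseteq> set vs \<and> \<beta> ws \<noteq> 0" using i by blast
qed

lemma wedge_scale:
  "(\<lambda>vs. r * \<alpha> vs) \<^bold>\<and> \<beta> = (\<lambda>vs. r * (\<alpha> \<^bold>\<and> \<beta>) vs)"
  "\<alpha> \<^bold>\<and> (\<lambda>vs. r * \<beta> vs) = (\<lambda>vs. r * (\<alpha> \<^bold>\<and> \<beta>) vs)"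
  by (simp_all add: fun_eq_iff wedge_def sum_distrib_left mult_ac)

lemma alternating_form_linear_scale:
  assumes "alternating_form k \<omega>"
  shows "\<omega> (a @ map (\<lambda>j. s j *\<^sub>R d j) js @ b) = (\<Prod>j\<leftarrow>js. s j) * \<omega> (a @ map d js @ b)"
proof (induction js arbitrary: a)
  case (Cons j js)
  have "\<omega> (a @ s j *\<^sub>R d j # map (\<lambda>j. s j *\<^sub>R d j) js @ b)
      = s j * \<omega> (a @ d j # map (\<lambda>j. s j *\<^sub>R d j) js @ b)"
    using linear_scale[OF alternating_form_linear[OF assms, of a "map (\<lambda>j. s j *\<^sub>R d j) js @ b"], of "s j" "d j"]
    by simp
  also have "\<omega> (a @ d j # map (\<lambda>j. s j *\<^sub>R d j) js @ b)
      = (\<Prod>j\<leftarrow>js. s j) * \<omega> (a @ d j # map d js @ b)"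
    using Cons.IH[of "a @ [d j]"] by simp
  finally show ?case by simp
qed simp

section \<open>Dual frames and the Hodge star\<close>

lemma coframe_alternating: "coframe x \<Longrightarrow> i \<in> {1..7} \<Longrightarrow> alternating_form 1 (x i)"
  by (simp add: coframe_def)

lemma covector_linear:
  assumes "alternating_form 1 \<alpha>"
  shows "linear (\<lambda>v. \<alpha> [v])"
  using alternating_form_linear[OF assms, of "[]" "[]"] by simp

section \<open>The matrix of a coframe and its dual vectors\<close>

lemma ex_coframe_index_bij: "\<exists>h. bij_betw h (UNIV :: 7 set) {1..7::nat}"
  by (rule finite_same_card_bij) auto

text \<open>Matrices carry the index type \<open>7\<close>, coframes the numbers 1 to 7. Any
  bijection will do, since renumbering the equations of a linear system changes neither its
  solvability nor its solution.\<close>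

definition coframe_index :: "7 \<Rightarrow> nat" where
  "coframe_index = (SOME h. bij_betw h UNIV {1..7})"

lemma bij_coframe_index: "bij_betw coframe_index UNIV {1..7}"
  unfolding coframe_index_def by (rule someI_ex[OF ex_coframe_index_bij])

definition coframe_matrix :: "(nat \<Rightarrow> (real^7) ext_form) \<Rightarrow> real^7^7" where
  "coframe_matrix x = (\<chi> i j. x (coframe_index i) [axis j 1])"

lemma index_in: "coframe_index i \<in> {1..7}"
  using bij_coframe_index by (auto simp: bij_betw_def)

lemma all_index: "(\<forall>i\<in>{1..7}. P i) \<longleftrightarrow> (\<forall>i. P (coframe_index i))"
  using bij_coframe_index by (metis (no_types, lifting) UNIV_I bij_betw_def imageE index_in)

lemma sum_index: "(\<Sum>i=1..7. f i) = (\<Sum>i\<in>UNIV. f (coframe_index i))"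
  by (rule sum.reindex_bij_betw[OF bij_coframe_index, symmetric])

lemma linear_axis_expansion:
  fixes f :: "real^'n \<Rightarrow> real"
  assumes "linear f"
  shows "f v = (\<Sum>k\<in>UNIV. v $ k * f (axis k 1))"
proof -
  have "f v = f (\<Sum>k\<in>UNIV. (v $ k) *\<^sub>R axis k 1)"
    by (simp add: basis_expansion flip: scalar_mult_eq_scaleR)
  also have "\<dots> = (\<Sum>k\<in>UNIV. v $ k * f (axis k 1))"
    by (simp add: linear_sum[OF assms] linear_scale[OF assms])
  finally show ?thesis .
qed

lemma coframe_matrix_vector:
  assumes "\<forall>i\<in>{1..7}. alternating_form 1 (x i)"
  shows "(coframe_matrix x *v v) $ i = x (coframe_index i) [v]"
proof -
  have "linear (\<lambda>v. x (coframe_index i) [v])"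
    using assms index_in by (intro covector_linear) auto
  from linear_axis_expansion[OF this, of v] show ?thesis
    by (simp add: coframe_matrix_def matrix_vector_mult_def mult.commute)
qed

text \<open>Linear independence of the covectors says that no nontrivial combination of the rows
  vanishes, which is triviality of the kernel of the transpose.\<close>

lemma coframe_det:
  assumes "coframe x"
  shows "det (coframe_matrix x) \<noteq> 0"
proof -
  let ?A = "coframe_matrix x"
  have alt: "\<forall>i\<in>{1..7}. alternating_form 1 (x i)"
    using assms by (simp add: coframe_def)
  have "a = 0" if "transpose ?A *v a = 0" for a
  proof -
    define b where "b j = a $ inv_into UNIV coframe_index j" for j
    have b: "b (coframe_index i) = a $ i" for i
      using bij_coframe_index by (simp add: b_def bij_betw_def inv_into_f_f)
    have "(\<Sum>i=1..7. b i * x i [v]) = 0" for v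
    proof -
      have "(\<Sum>i=1..7. b i * x i [v]) = (\<Sum>i\<in>UNIV. a $ i * (?A *v v) $ i)"
        by (simp add: sum_index b coframe_matrix_vector[OF alt] del: One_nat_def)
      also have "\<dots> = a \<bullet> (?A *v v)" by (simp add: inner_vec_def)
      also have "\<dots> = (transpose ?A *v a) \<bullet> v" by (simp add: dot_lmul_matrix)
      finally show ?thesis using that by simp
    qed
    then have "\<forall>i\<in>{1..7}. b i = 0" using assms by (simp add: coframe_def)
    then have "\<forall>i. a $ i = 0" by (simp add: all_index b del: One_nat_def)
    then show "a = 0" by (simp add: vec_eq_iff)
  qed
  then have "invertible (transpose ?A)"
    by (simp add: invertible_left_inverse matrix_left_invertible_ker)
  then show ?thesis by (simp add: invertible_det_nz)
qed

lemma ex1_dual_vector: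
  assumes "coframe x"
  shows "\<exists>!v. \<forall>i\<in>{1..7}. x i [v] = (if i = j then 1 else 0)"
proof -
  have alt: "\<forall>i\<in>{1..7}. alternating_form 1 (x i)"
    using assms by (simp add: coframe_def)
  have "(\<forall>i\<in>{1..7}. x i [v] = (if i = j then 1 else 0)) \<longleftrightarrow>
      coframe_matrix x *v v = (\<chi> i. if coframe_index i = j then 1 else 0)" for v
    by (simp add: all_index vec_eq_iff coframe_matrix_vector[OF alt] del: One_nat_def)
  then show ?thesis by (simp add: cramer[OF coframe_det[OF assms]])
qed

lemma dual_vector:
  assumes "coframe x" "i \<in> {1..7}"
  shows "x i [dual_vector x j] = (if i = j then 1 else 0)"
  using theI'[OF ex1_dual_vector[OF assms(1), of j]] assms(2) by (simp add: dual_vector_def)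

lemma dual_vector_unique:
  assumes "coframe x" "\<forall>i\<in>{1..7}. x i [v] = (if i = j then 1 else 0)"
  shows "dual_vector x j = v"
  unfolding dual_vector_def
  by (rule the1_equality[OF ex1_dual_vector[OF assms(1)] assms(2)])

text \<open>The THE in \<open>dual_vector\<close> gives no control over the dependence on a base
  point. This formula does: it is a quotient of polynomials in the values of the covectors on the
  axes.\<close>

lemma dual_vector_cramer:
  assumes "coframe x"
  shows "dual_vector x j = (\<chi> k. det (\<chi> i l. if l = k then if coframe_index i = j then 1 else 0
    else coframe_matrix x $ i $ l) / det (coframe_matrix x))" (is "_ = ?v")
proof (rule dual_vector_unique[OF assms])
  have alt: "\<forall>i\<in>{1..7}. alternating_form 1 (x i)"
    using assms by (simp add: coframe_def)
  have "coframe_matrix x *v ?v = (\<chi> i. if coframe_index i = j then 1 else 0)"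
    by (subst cramer[OF coframe_det[OF assms]]) (simp cong: if_cong)
  then show "\<forall>i\<in>{1..7}. x i [?v] = (if i = j then 1 else 0)"
    by (simp add: all_index vec_eq_iff coframe_matrix_vector[OF alt] del: One_nat_def)
qed

lemma coframe_eqI:
  assumes "coframe x" "\<And>i. i \<in> {1..7} \<Longrightarrow> x i [v] = x i [w]"
  shows "v = w"
proof -
  have alt: "\<forall>i\<in>{1..7}. alternating_form 1 (x i)"
    using assms by (simp add: coframe_def)
  have *: "coframe_matrix x *v v = coframe_matrix x *v w"
    using assms(2)[OF index_in] by (simp add: vec_eq_iff coframe_matrix_vector[OF alt])
  note D = cramer[OF coframe_det[OF assms(1)]]
  show ?thesis
    by (rule trans[OF iffD1[OF D *] sym[OF iffD1[OF D refl]]])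
qed

lemma dual_vector_expansion:
  assumes "coframe x"
  shows "v = (\<Sum>j=1..7. x j [v] *\<^sub>R dual_vector x j)"
proof (rule coframe_eqI[OF assms])
  fix i :: nat assume i: "i \<in> {1..7}"
  have l: "linear (\<lambda>v. x i [v])" by (rule covector_linear[OF coframe_alternating[OF assms i]])
  show "x i [v] = x i [\<Sum>j=1..7. x j [v] *\<^sub>R dual_vector x j]"
    using i by (simp add: linear_sum[OF l] linear_scale[OF l] dual_vector[OF assms i] if_distrib sum.delta cong: if_cong)
qed

lemma length_dual_vectors [simp]: "length (dual_vectors x I) = card I"
  by (simp add: dual_vectors_def)

text \<open>Arguments are replaced from the left by their expansions in dual vectors,
  \<open>js\<close> recording the indices chosen so far. At the end \<open>js\<close> has a
  repetition, has the wrong length, or is a rearrangement of some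
  \<open>dual_vectors x K\<close>.\<close>

lemma alternating_form_zeroI:
  assumes x: "coframe x" and \<omega>: "alternating_form k \<omega>"
    and z: "\<And>K. K \<subseteq> {1..7} \<Longrightarrow> card K = k \<Longrightarrow> \<omega> (dual_vectors x K) = 0"
  shows "\<omega> vs = 0"
proof -
  let ?d = "dual_vector x"
  have "\<omega> (map ?d js @ vs) = 0" if "set js \<subseteq> {1..7}" for js
    using that
  proof (induction vs arbitrary: js)
    case Nil
    consider "\<not> distinct js" | "length js \<noteq> k" | "distinct js" "length js = k" by blast
    then show ?case
    proof cases
      case 1
      then show ?thesis by (intro alternating_form_not_distinct[OF \<omega>]) (simp add: distinct_map)
    next
      case 2
      then show ?thesis by (intro alternating_form_length[OF \<omega>]) simp
    next
      case 3
      have "mset js = mset (sorted_list_of_set (set js))"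
        using 3 by (simp add: distinct_sorted_list_of_set set_eq_iff_mset_eq_distinct[symmetric])
      then have "\<bar>\<omega> (map ?d js)\<bar> = \<bar>\<omega> (dual_vectors x (set js))\<bar>"
        unfolding dual_vectors_def by (intro alternating_form_permute[OF \<omega>]) simp
      also have "\<dots> = 0" using 3 Nil by (simp add: z distinct_card)
      finally show ?thesis by simp
    qed
  next
    case (Cons w vs)
    have l: "linear (\<lambda>w. \<omega> (map ?d js @ w # vs))" by (rule alternating_form_linear[OF \<omega>])
    have "\<omega> (map ?d js @ w # vs) = \<omega> (map ?d js @ (\<Sum>j=1..7. x j [w] *\<^sub>R ?d j) # vs)"
      using dual_vector_expansion[OF x, of w] by simp
    also have "\<dots> = (\<Sum>j=1..7. x j [w] * \<omega> (map ?d (js @ [j]) @ vs))"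
      by (simp add: linear_sum[OF l] linear_scale[OF l])
    also have "\<dots> = 0"
    proof (intro sum.neutral ballI)
      fix j :: nat assume "j \<in> {1..7}"
      then have "\<omega> (map ?d (js @ [j]) @ vs) = 0" using Cons.prems by (intro Cons.IH) auto
      then show "x j [w] * \<omega> (map ?d (js @ [j]) @ vs) = 0" by simp
    qed
    finally show ?case .
  qed
  from this[of "[]"] show ?thesis by simp
qed

lemma alternating_form_eqI:
  assumes "coframe x" "alternating_form k \<omega>" "alternating_form k \<eta>"
    and "\<And>K. K \<subseteq> {1..7} \<Longrightarrow> card K = k \<Longrightarrow> \<omega> (dual_vectors x K) = \<eta> (dual_vectors x K)"
  shows "\<omega> = \<eta>"
proof
  fix vs
  have "alternating_form k (\<lambda>vs. \<omega> vs + - 1 * \<eta> vs)"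
    by (intro alternating_form_add alternating_form_scale assms)
  from alternating_form_zeroI[OF assms(1) this, of vs] show "\<omega> vs = \<eta> vs"
    using assms(4) by simp
qed

section \<open>Volume form and Hodge star at a point\<close>

lemma alternating_form_wedge3:
  assumes "alternating_form 1 a" "alternating_form 1 b" "alternating_form 1 c"
  shows "alternating_form 3 (a \<^bold>\<and> b \<^bold>\<and> c)"
  using alternating_form_wedge[OF assms(1) alternating_form_wedge[OF assms(2,3)]]
  by (simp add: numeral_3_eq_3)

lemma alternating_volume_form:
  assumes "\<forall>i\<in>{1..7}. alternating_form 1 (x i)"
  shows "alternating_form 7 (volume_form x)"
proof -
  have "alternating_form (Suc (Suc (Suc (Suc (Suc (Suc 1)))))) (volume_form x)"
    unfolding volume_form_def using assms by (intro alternating_form_wedge) auto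
  then show ?thesis by (simp add: eval_nat_numeral)
qed

lemma volume_form_dual:
  assumes x: "coframe x"
  shows "volume_form x (dual_vectors x {1..7}) = 1"
proof -
  have "{1..7::nat} = set [1, 2, 3, 4, 5, 6, 7]" by auto
  moreover have "sorted_list_of_set (set [1, 2, 3, 4, 5, 6, 7 :: nat]) = [1, 2, 3, 4, 5, 6, 7]"
    by (rule sorted_list_of_set.idem_if_sorted_distinct) auto
  ultimately have "sorted_list_of_set {1..7::nat} = [1, 2, 3, 4, 5, 6, 7]" by simp
  then have "dual_vectors x {1..7} = map (dual_vector x) [1, 2, 3, 4, 5, 6, 7]"
    by (simp add: dual_vectors_def)
  then show ?thesis
    by (simp add: volume_form_def wedge_covector_Cons coframe_alternating[OF x] dual_vector[OF x]
      del: One_nat_def)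
qed

text \<open>Pigeonhole: if the cardinalities add up to 7 and the sets are not complementary, they
  share an index, whose dual vector then occurs twice. On a list of dual vectors this leaves a
  single summand of \<open>hodge\<close>.\<close>

lemma volume_form_disjoint:
  assumes x: "coframe x" and "I \<subseteq> {1..7}" "J \<subseteq> {1..7}" "card I + card J = 7" "J \<noteq> {1..7} - I"
  shows "volume_form x (dual_vectors x I @ dual_vectors x J) = 0"
proof -
  have fin: "finite I" "finite J" using assms finite_subset by blast+
  have "I \<inter> J \<noteq> {}"
  proof
    assume "I \<inter> J = {}"
    then have "card (I \<union> J) = card {1..7::nat}" using assms fin by (simp add: card_Un_disjoint)
    then have "I \<union> J = {1..7}" using assms(2,3) by (intro card_subset_eq) auto
    then show False using \<open>I \<inter> J = {}\<close> assms by blast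
  qed
  then have "\<not> distinct (dual_vectors x I @ dual_vectors x J)"
    using fin by (auto simp: dual_vectors_def)
  then show ?thesis
    using alternating_volume_form x alternating_form_not_distinct unfolding coframe_def by blast
qed

text \<open>The factors are the two signs that arise when the star is applied twice to the basis
  element with index set \<open>I\<close>.\<close>

lemma volume_form_complement:
  assumes x: "coframe x" and "I \<subseteq> {1..7}"
  shows "volume_form x (dual_vectors x I @ dual_vectors x ({1..7} - I))
    * volume_form x (dual_vectors x ({1..7} - I) @ dual_vectors x I) = 1" (is "?a * ?b = 1")
proof -
  have vol: "alternating_form 7 (volume_form x)"
    using x by (simp add: coframe_def alternating_volume_form)
  have fin: "finite I" using assms finite_subset by blast
  then have card: "card ({1..7} - I) = 7 - card I" "card I \<le> 7"
    using assms card_mono[of "{1..7}" I] by (auto simp: card_Diff_subset)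
  \<comment> \<open>\<open>k (7 - k)\<close> is even, so the Hodge star squares to the identity in every degree.\<close>
  then have "even (card I * card ({1..7} - I))" by auto
  then have ab: "?a = ?b"
    using alternating_form_move_block[OF vol, of "[]" "dual_vectors x I" "dual_vectors x ({1..7} - I)"]
    by simp
  have "set (sorted_list_of_set I @ sorted_list_of_set ({1..7} - I)) = set (sorted_list_of_set {1..7})"
    using assms(2) fin by auto
  then have "mset (sorted_list_of_set I @ sorted_list_of_set ({1..7} - I)) = mset (sorted_list_of_set {1..7})"
    using fin by (subst set_eq_iff_mset_eq_distinct[symmetric]) auto
  then have "\<bar>?a\<bar> = \<bar>volume_form x (dual_vectors x {1..7})\<bar>"
    unfolding dual_vectors_def
    by (intro alternating_form_permute[OF vol]) (metis map_append mset_map)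
  then have "\<bar>?a\<bar> = 1" by (simp only: volume_form_dual[OF x] abs_one)
  then show ?thesis by (metis ab abs_mult_self_eq mult.right_neutral)
qed

lemma hodge_dual_vectors:
  assumes x: "coframe x" and K: "K \<subseteq> {1..7}"
  shows "hodge x \<omega> (dual_vectors x K) = \<omega> (dual_vectors x ({1..7} - K))
    * volume_form x (dual_vectors x ({1..7} - K) @ dual_vectors x K)"
proof -
  have fin: "finite K" using K finite_subset by blast
  have card: "card ({1..7} - K) + card K = 7"
    using K fin card_mono[of "{1..7}" K] by (auto simp: card_Diff_subset)
  let ?g = "\<lambda>I. \<omega> (dual_vectors x I) * volume_form x (dual_vectors x I @ dual_vectors x K)"
  have "hodge x \<omega> (dual_vectors x K) = (\<Sum>I | I \<subseteq> {1..7} \<and> card I + card K = 7. ?g I)"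
    by (simp add: hodge_def)
  also have "\<dots> = (\<Sum>I\<in>{{1..7} - K}. ?g I)"
    using card K
    by (intro sum.mono_neutral_right) (auto intro!: volume_form_disjoint[OF x])
  finally show ?thesis by simp
qed

lemma alternating_form_hodge:
  assumes x: "\<forall>i\<in>{1..7}. alternating_form 1 (x i)" and \<omega>: "alternating_form k \<omega>" and k: "k \<le> 7"
  shows "alternating_form (7 - k) (hodge x \<omega>)"
proof (rule alternating_formI)
  fix vs :: "(real^7) list"
  assume "length vs \<noteq> 7 - k"
  then have "\<omega> (dual_vectors x I) = 0" if "card I + length vs = 7" for I
    using that k by (intro alternating_form_length[OF \<omega>]) auto
  then show "hodge x \<omega> vs = 0" by (simp add: hodge_def)
next
  fix a b :: "(real^7) list"
  have "linear (\<lambda>v. \<omega> (dual_vectors x I) * volume_form x (dual_vectors x I @ a @ v # b))" for I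
    using alternating_form_linear[OF alternating_volume_form[OF x], of "dual_vectors x I @ a" b]
    by (simp add: linear_times)
  then show "linear (\<lambda>v. hodge x \<omega> (a @ v # b))"
    unfolding hodge_def length_append list.size by (intro linear_compose_sum) simp
next
  fix vs :: "(real^7) list"
  assume "\<not> distinct vs"
  then have "volume_form x (ws @ vs) = 0" for ws
    by (intro alternating_form_not_distinct[OF alternating_volume_form[OF x]]) simp
  then show "hodge x \<omega> vs = 0" by (simp add: hodge_def)
qed

lemma hodge_hodge:
  assumes x: "coframe x" and \<omega>: "alternating_form k \<omega>" and k: "k \<le> 7"
  shows "hodge x (hodge x \<omega>) = \<omega>"
proof (rule alternating_form_eqI[OF x _ \<omega>])
  have alt: "\<forall>i\<in>{1..7}. alternating_form 1 (x i)" using x by (simp add: coframe_def)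
  show "alternating_form k (hodge x (hodge x \<omega>))"
    using alternating_form_hodge[OF alt alternating_form_hodge[OF alt \<omega> k]] k by simp
  fix K :: "nat set"
  assume K: "K \<subseteq> {1..7}"
  then have "{1..7} - ({1..7} - K) = K" by blast
  then show "hodge x (hodge x \<omega>) (dual_vectors x K) = \<omega> (dual_vectors x K)"
    using volume_form_complement[OF x K] K by (simp add: hodge_dual_vectors[OF x])
qed

section \<open>Dependence of the Hodge star on a rescaling of the coframe\<close>

context
  fixes x y :: "nat \<Rightarrow> (real^7) ext_form" and r :: "nat \<Rightarrow> real"
  assumes x: "coframe x" and r: "\<And>i. i \<in> {1..7} \<Longrightarrow> r i \<noteq> 0"
    and y: "\<And>i. i \<in> {1..7} \<Longrightarrow> y i = (\<lambda>vs. r i * x i vs)"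
begin

lemma coframe_scale: "coframe y"
  unfolding coframe_def
proof (intro conjI ballI allI impI)
  fix i :: nat assume i: "i \<in> {1..7}"
  then show "alternating_form 1 (y i)"
    by (simp only: y) (intro alternating_form_scale coframe_alternating[OF x])
next
  fix a :: "nat \<Rightarrow> real" and i :: nat
  assume "\<forall>v. (\<Sum>i=1..7. a i * y i [v]) = 0" and i: "i \<in> {1..7}"
  moreover have "(\<Sum>i=1..7. a i * y i [v]) = (\<Sum>i=1..7. (a i * r i) * x i [v])" for v
    by (intro sum.cong) (simp_all add: y)
  ultimately have "\<forall>v. (\<Sum>i=1..7. (a i * r i) * x i [v]) = 0" by simp
  moreover have "(\<forall>v. (\<Sum>i=1..7. b i * x i [v]) = 0) \<Longrightarrow> \<forall>i\<in>{1..7}. b i = 0" for b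
    using x unfolding coframe_def by blast
  ultimately have "\<forall>i\<in>{1..7}. a i * r i = 0" by iprover
  then show "a i = 0" using i r by auto
qed

lemma dual_vector_scale:
  assumes "j \<in> {1..7}"
  shows "dual_vector y j = (1 / r j) *\<^sub>R dual_vector x j"
proof (rule dual_vector_unique[OF coframe_scale], intro ballI)
  fix i :: nat assume i: "i \<in> {1..7}"
  have "y i [(1 / r j) *\<^sub>R dual_vector x j] = r i * ((1 / r j) * x i [dual_vector x j])"
    using linear_scale[OF covector_linear[OF coframe_alternating[OF x i]]] by (simp add: y[OF i])
  then show "y i [(1 / r j) *\<^sub>R dual_vector x j] = (if i = j then 1 else 0)"
    using r[OF assms] by (simp add: dual_vector[OF x i])
qed

lemma volume_form_scale: "volume_form y vs = (\<Prod>i=1..7. r i) * volume_form x vs"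
proof -
  have *: "1 \<in> {1..7::nat}" "2 \<in> {1..7::nat}" "3 \<in> {1..7::nat}" "4 \<in> {1..7::nat}"
    "5 \<in> {1..7::nat}" "6 \<in> {1..7::nat}" "7 \<in> {1..7::nat}" by auto
  have "volume_form y vs = r 1 * (r 2 * (r 3 * (r 4 * (r 5 * (r 6 * (r 7 * volume_form x vs))))))"
    by (simp only: volume_form_def y[OF *(1)] y[OF *(2)] y[OF *(3)] y[OF *(4)] y[OF *(5)]
        y[OF *(6)] y[OF *(7)] wedge_scale)
  moreover have "{1..7::nat} = {1, 2, 3, 4, 5, 6, 7}" by auto
  ultimately show ?thesis by simp
qed

lemma alternating_form_dual_scale:
  assumes \<omega>: "alternating_form k \<omega>" and I: "I \<subseteq> {1..7}"
  shows "\<omega> (dual_vectors y I @ vs) = \<omega> (dual_vectors x I @ vs) / (\<Prod>i\<in>I. r i)"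
proof -
  have fin: "finite I" using I finite_subset by blast
  have "dual_vectors y I = map (\<lambda>j. (1 / r j) *\<^sub>R dual_vector x j) (sorted_list_of_set I)"
    unfolding dual_vectors_def using I fin by (intro map_cong refl dual_vector_scale) auto
  then have "\<omega> (dual_vectors y I @ vs)
      = (\<Prod>j\<leftarrow>sorted_list_of_set I. 1 / r j) * \<omega> (dual_vectors x I @ vs)"
    using alternating_form_linear_scale[OF \<omega>, of "[]" "\<lambda>j. 1 / r j" "dual_vector x"]
    by (simp only: dual_vectors_def append_Nil)
  also have "(\<Prod>j\<leftarrow>sorted_list_of_set I. 1 / r j) = (\<Prod>j\<in>I. 1 / r j)"
    using fin prod.distinct_set_conv_list[of "sorted_list_of_set I" "\<lambda>j. 1 / r j"] by simp
  also have "\<dots> = 1 / (\<Prod>j\<in>I. r j)" by (simp add: prod_dividef)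
  finally show ?thesis by simp
qed

text \<open>The volume form contributes the product of all \<open>r i\<close>. The product over
  \<open>I\<close> is squared because the rescaled dual vectors enter twice, as arguments of
  \<omega> and of the volume form.\<close>

lemma hodge_scale:
  assumes \<omega>: "alternating_form k \<omega>"
  shows "hodge y \<omega> vs = (\<Sum>I | I \<subseteq> {1..7} \<and> card I + length vs = 7.
    ((\<Prod>i=1..7. r i) / (\<Prod>i\<in>I. r i)\<^sup>2) *
      (\<omega> (dual_vectors x I) * volume_form x (dual_vectors x I @ vs)))"
  unfolding hodge_def
proof (intro sum.cong refl)
  fix I :: "nat set" assume "I \<in> {I. I \<subseteq> {1..7} \<and> card I + length vs = 7}"
  then have I: "I \<subseteq> {1..7}" by simp
  have "alternating_form 7 (volume_form x)"
    using x by (simp add: coframe_def alternating_volume_form)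
  then show "\<omega> (dual_vectors y I) * volume_form y (dual_vectors y I @ vs)
    = ((\<Prod>i=1..7. r i) / (\<Prod>i\<in>I. r i)\<^sup>2) *
      (\<omega> (dual_vectors x I) * volume_form x (dual_vectors x I @ vs))"
    using alternating_form_dual_scale[OF \<omega> I, of "[]"]
    by (simp add: volume_form_scale alternating_form_dual_scale[OF _ I] power2_eq_square)
qed

text \<open>On the dual vectors of \<open>x\<close> the product of \<open>x i\<close>,
  \<open>x j\<close>, \<open>x k\<close> is supported on the index set \<open>{i, j, k}\<close>, so
  \<open>hodge_scale\<close> contributes a single factor. The coefficient
  \<open>r i * r j * r k\<close> of the rescaled product cancels one power of the squared
  denominator.\<close>

lemma hodge_scale_wedge3:
  assumes ijk: "{i, j, k} \<subseteq> {1..7}" "card {i, j, k} = 3"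
  shows "hodge y (y i \<^bold>\<and> y j \<^bold>\<and> y k) vs
    = (\<Prod>i=1..7. r i) / (r i * r j * r k) * hodge x (x i \<^bold>\<and> x j \<^bold>\<and> x k) vs"
proof -
  let ?e = "x i \<^bold>\<and> x j \<^bold>\<and> x k" and ?P = "\<Prod>i=1..7. r i" and ?p = "r i * r j * r k"
  have alt: "alternating_form 1 (x l)" if "l \<in> {i, j, k}" for l
    using that ijk by (intro coframe_alternating[OF x]) auto
  have e: "alternating_form 3 ?e" by (intro alternating_form_wedge3 alt) auto
  have p: "(\<Prod>i\<in>{i, j, k}. r i) = ?p"
    using ijk(2) by (auto simp: card_insert_if mult.assoc split: if_splits)
  have p0: "?p \<noteq> 0" using r ijk by auto
  have ye: "y i \<^bold>\<and> y j \<^bold>\<and> y k = (\<lambda>vs. ?p * ?e vs)"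
    using y[of i] y[of j] y[of k] ijk(1) by (simp add: wedge_scale mult_ac)
  \<comment> \<open>Each of the three covectors must be nonzero on some dual vector with index in
    \<open>I\<close>, which puts its own index into \<open>I\<close>; the degree gives
    \<open>card I = 3\<close>.\<close>
  have *: "I = {i, j, k}" if I: "I \<subseteq> {1..7}" and nz: "?e (dual_vectors x I) \<noteq> 0" for I
  proof -
    have fin: "finite I" using I finite_subset by blast
    have l: "l \<in> I" if "v \<in> set (dual_vectors x I)" "x l [v] \<noteq> 0" "l \<in> {i, j, k}" for v l
      using that fin I ijk dual_vector[OF x, of l] by (auto simp: dual_vectors_def split: if_splits)
    have a: "alternating_form 1 (x i)" "alternating_form 1 (x j)" "alternating_form 1 (x k)"
      using alt by blast+
    obtain ws where ws: "set ws \<subseteq> set (dual_vectors x I)" "(x j \<^bold>\<and> x k) ws \<noteq> 0"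
      using wedge_covector_nonzero(2)[OF a(1) nz] by blast
    obtain us where us: "set us \<subseteq> set ws" "x k us \<noteq> 0"
      using wedge_covector_nonzero(2)[OF a(2) ws(2)] by blast
    have "length us = 1" using alternating_form_length[OF a(3)] us(2) by blast
    then obtain u where u: "us = [u]" by (auto simp: length_Suc_conv)
    have "i \<in> I" using wedge_covector_nonzero(1)[OF a(1) nz] l by blast
    moreover have "j \<in> I" using wedge_covector_nonzero(1)[OF a(2) ws(2)] ws(1) l by blast
    moreover have "k \<in> I" using us ws(1) u by (intro l[of u k]) auto
    moreover have "card I = 3" using alternating_form_length[OF e] nz by force
    ultimately show ?thesis using ijk fin by (intro card_seteq[symmetric]) auto
  qed
  have "hodge y (y i \<^bold>\<and> y j \<^bold>\<and> y k) vs = ?p * hodge y ?e vs"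
    by (simp add: ye hodge_def sum_distrib_left mult.assoc)
  also have "\<dots> = ?P / ?p * hodge x ?e vs"
    unfolding hodge_scale[OF e] unfolding hodge_def sum_distrib_left
  proof (intro sum.cong refl)
    fix I :: "nat set" assume I: "I \<in> {I. I \<subseteq> {1..7} \<and> card I + length vs = 7}"
    show "?p * (?P / (\<Prod>i\<in>I. r i)\<^sup>2 * (?e (dual_vectors x I) * volume_form x (dual_vectors x I @ vs)))
        = ?P / ?p * (?e (dual_vectors x I) * volume_form x (dual_vectors x I @ vs))"
    proof (cases "?e (dual_vectors x I) = 0")
      case False
      then have "(\<Prod>i\<in>I. r i) = ?p" using *[of I] I p by simp
      then show ?thesis using p0 by (simp add: power2_eq_square)
    qed simp
  qed
  finally show ?thesis .
qed

end

text \<open>In degree \<open>k\<close> only index sets with \<open>k\<close> elements contribute to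
  \<open>hodge_scale\<close>, and on these its factor is constant.\<close>

lemma hodge_homothety:
  assumes x: "coframe x" and "r \<noteq> 0" and y: "\<And>i. i \<in> {1..7} \<Longrightarrow> y i = (\<lambda>vs. r * x i vs)"
    and \<omega>: "alternating_form k \<omega>"
  shows "hodge y \<omega> vs = r ^ 7 / r ^ (2 * k) * hodge x \<omega> vs"
proof -
  have "hodge y \<omega> vs = (\<Sum>I | I \<subseteq> {1..7} \<and> card I + length vs = 7.
    ((\<Prod>i=1..7::nat. r) / (\<Prod>i\<in>I. r)\<^sup>2) *
      (\<omega> (dual_vectors x I) * volume_form x (dual_vectors x I @ vs)))"
    by (rule hodge_scale[OF x \<open>r \<noteq> 0\<close> y \<omega>])
  also have "\<dots> = r ^ 7 / r ^ (2 * k) * hodge x \<omega> vs"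
    unfolding hodge_def sum_distrib_left
  proof (intro sum.cong refl)
    fix I :: "nat set" assume "I \<in> {I. I \<subseteq> {1..7} \<and> card I + length vs = 7}"
    show "(\<Prod>i=1..7::nat. r) / (\<Prod>i\<in>I. r)\<^sup>2 * (\<omega> (dual_vectors x I) * volume_form x (dual_vectors x I @ vs))
      = r ^ 7 / r ^ (2 * k) * (\<omega> (dual_vectors x I) * volume_form x (dual_vectors x I @ vs))"
    proof (cases "card I = k")
      case True
      then show ?thesis by (simp add: power_mult[symmetric] mult.commute)
    next
      case False
      then have "\<omega> (dual_vectors x I) = 0" by (intro alternating_form_length[OF \<omega>]) simp
      then show ?thesis by simp
    qed
  qed
  finally show ?thesis .
qed

lemma hodge_linear:
  "hodge x (\<lambda>vs. a * \<omega> vs + b * \<eta> vs) vs = a * hodge x \<omega> vs + b * hodge x \<eta> vs"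
  by (simp add: hodge_def sum_distrib_left sum.distrib[symmetric] algebra_simps)

section \<open>Smooth families of forms\<close>

lemma Ck_on_cong:
  assumes "open U" "\<And>x. x \<in> U \<Longrightarrow> f x = g x" "Ck_on k U f"
  shows "Ck_on k U g"
proof (cases k)
  case 0
  then show ?thesis using assms continuous_on_cong[of U U f g] by simp
next
  case (Suc n)
  then obtain f' where "\<forall>x\<in>U. (f has_derivative f' x) (at x)" "\<forall>v. Ck_on n U (\<lambda>x. f' x v)"
    using assms(3) by auto
  then show ?thesis
    using assms(1,2) has_derivative_transform_within_open unfolding Suc Ck_on.simps by blast
qed

lemma Ck_on_SucD: "Ck_on (Suc k) U f \<Longrightarrow> Ck_on k U f"
proof (induction k arbitrary: f)
  case 0
  then show ?case by (auto intro!: continuous_at_imp_continuous_on intro: has_derivative_continuous)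
next
  case (Suc k)
  then obtain f' where "\<forall>x\<in>U. (f has_derivative f' x) (at x)" "\<forall>v. Ck_on (Suc k) U (\<lambda>x. f' x v)"
    unfolding Ck_on.simps(2)[of "Suc k"] by blast
  then show ?case using Suc.IH unfolding Ck_on.simps(2)[of k] by blast
qed

lemma Ck_on_const: "Ck_on k U (\<lambda>x. c)"
proof (induction k arbitrary: c)
  case (Suc k)
  then show ?case by (auto intro!: exI[of _ "\<lambda>x v. 0"])
qed simp

lemma Ck_on_add: "Ck_on k U f \<Longrightarrow> Ck_on k U g \<Longrightarrow> Ck_on k U (\<lambda>x. f x + g x)"
proof (induction k arbitrary: f g)
  case 0
  then show ?case by (simp add: continuous_on_add)
next
  case (Suc k)
  then obtain f' g' where "\<forall>x\<in>U. (f has_derivative f' x) (at x)" "\<forall>v. Ck_on k U (\<lambda>x. f' x v)"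
    "\<forall>x\<in>U. (g has_derivative g' x) (at x)" "\<forall>v. Ck_on k U (\<lambda>x. g' x v)"
    by auto
  then show ?case
    using Suc.IH by (auto intro!: exI[of _ "\<lambda>x v. f' x v + g' x v"] has_derivative_add)
qed

lemma Ck_on_mult:
  fixes f g :: "'a::real_normed_vector \<Rightarrow> real"
  shows "Ck_on k U f \<Longrightarrow> Ck_on k U g \<Longrightarrow> Ck_on k U (\<lambda>x. f x * g x)"
proof (induction k arbitrary: f g)
  case 0
  then show ?case by (simp add: continuous_on_mult)
next
  case (Suc k)
  obtain f' g' where "\<forall>x\<in>U. (f has_derivative f' x) (at x)" "\<forall>v. Ck_on k U (\<lambda>x. f' x v)"
    "\<forall>x\<in>U. (g has_derivative g' x) (at x)" "\<forall>v. Ck_on k U (\<lambda>x. g' x v)"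
    using Suc.prems by auto
  moreover have "Ck_on k U f" "Ck_on k U g" using Suc.prems Ck_on_SucD by blast+
  ultimately show ?case
    using Suc.IH
    by (auto intro!: exI[of _ "\<lambda>x v. f x * g' x v + f' x v * g x"] has_derivative_mult Ck_on_add)
qed

lemma Ck_on_inverse:
  fixes f :: "'a::real_normed_vector \<Rightarrow> real"
  assumes "\<forall>x\<in>U. f x \<noteq> 0"
  shows "Ck_on k U f \<Longrightarrow> Ck_on k U (\<lambda>x. inverse (f x))"
proof (induction k)
  case 0
  then show ?case using assms by (simp add: continuous_on_inverse)
next
  case (Suc k)
  obtain f' where f': "\<forall>x\<in>U. (f has_derivative f' x) (at x)" "\<forall>v. Ck_on k U (\<lambda>x. f' x v)"
    using Suc.prems by auto
  have "Ck_on k U (\<lambda>x. inverse (f x))" using Suc Ck_on_SucD by blast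
  then have "Ck_on k U (\<lambda>x. - 1 * (inverse (f x) * f' x v * inverse (f x)))" for v
    using f' by (intro Ck_on_mult Ck_on_const) auto
  then show ?case
    using f' assms
    by (auto intro!: exI[of _ "\<lambda>x v. - (inverse (f x) * f' x v * inverse (f x))"] Deriv.has_derivative_inverse)
qed

lemma Cinf_on_const: "Cinf_on U (\<lambda>x. c)"
  and Cinf_on_add: "Cinf_on U f \<Longrightarrow> Cinf_on U g \<Longrightarrow> Cinf_on U (\<lambda>x. f x + g x)"
  and Cinf_on_mult: "Cinf_on U p \<Longrightarrow> Cinf_on U q \<Longrightarrow> Cinf_on U (\<lambda>x. p x * q x)"
  and Cinf_on_divide: "\<forall>x\<in>U. q x \<noteq> 0 \<Longrightarrow> Cinf_on U p \<Longrightarrow> Cinf_on U q \<Longrightarrow> Cinf_on U (\<lambda>x. p x / q x)"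
  for f g :: "'a::real_normed_vector \<Rightarrow> 'b::real_normed_vector" and p q :: "'a \<Rightarrow> real"
  by (auto simp: Cinf_on_def divide_inverse
      intro!: Ck_on_const Ck_on_add Ck_on_mult Ck_on_inverse)

lemma Cinf_on_cong:
  "open U \<Longrightarrow> (\<And>x. x \<in> U \<Longrightarrow> f x = g x) \<Longrightarrow> Cinf_on U f \<Longrightarrow> Cinf_on U g"
  unfolding Cinf_on_def using Ck_on_cong by blast

lemma Cinf_on_sum: "(\<And>i. i \<in> I \<Longrightarrow> Cinf_on U (f i)) \<Longrightarrow> Cinf_on U (\<lambda>x. \<Sum>i\<in>I. f i x)"
  by (induction I rule: infinite_finite_induct) (auto intro: Cinf_on_const Cinf_on_add)

lemma Cinf_on_prod:
  fixes f :: "'i \<Rightarrow> 'a::real_normed_vector \<Rightarrow> real"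
  shows "(\<And>i. i \<in> I \<Longrightarrow> Cinf_on U (f i)) \<Longrightarrow> Cinf_on U (\<lambda>x. \<Prod>i\<in>I. f i x)"
  by (induction I rule: infinite_finite_induct) (auto intro: Cinf_on_const Cinf_on_mult)

lemma Cinf_on_det:
  fixes M :: "'a::real_normed_vector \<Rightarrow> real^'n^'n"
  assumes "\<And>i j. Cinf_on U (\<lambda>x. M x $ i $ j)"
  shows "Cinf_on U (\<lambda>x. det (M x))"
  unfolding det_def by (intro Cinf_on_sum Cinf_on_mult Cinf_on_const Cinf_on_prod assms)

lemma Cinf_on_differentiable:
  assumes "Cinf_on U f" "x \<in> U"
  shows "f differentiable at x"
proof -
  have "Ck_on (Suc 0) U f" using assms(1) by (simp only: Cinf_on_def)
  then show ?thesis using assms(2) by (auto simp: differentiable_def)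
qed

lemma Cinf_on_frechet_derivative:
  assumes "open U" "Cinf_on U f"
  shows "Cinf_on U (\<lambda>x. frechet_derivative f (at x) v)"
  unfolding Cinf_on_def
proof
  fix k
  have "Ck_on (Suc k) U f" using assms(2) by (simp only: Cinf_on_def)
  then obtain f' where f': "\<forall>x\<in>U. (f has_derivative f' x) (at x)" "Ck_on k U (\<lambda>x. f' x v)"
    by auto
  \<comment> \<open>\<open>Ck_on\<close> only asserts that some derivative \<open>f'\<close> exists;
    uniqueness of derivatives identifies it with \<open>frechet_derivative\<close> at every point of
    \<open>U\<close>.\<close>
  show "Ck_on k U (\<lambda>x. frechet_derivative f (at x) v)"
    using f'(1) by (intro Ck_on_cong[OF assms(1) _ f'(2)]) (metis frechet_derivative_at)
qed

text \<open>One rule for sums, multiples, congruence and vanishing, according to the choice of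
  \<open>a\<close> and \<open>b\<close>. The identity is required only on an open set, as the
  operators on forms are controlled only inside a chart.\<close>

lemma frechet_derivative_combination:
  fixes f g h :: "'a::real_normed_vector \<Rightarrow> real"
  assumes "open U" "y \<in> U" "g differentiable at y" "h differentiable at y"
    and "\<And>z. z \<in> U \<Longrightarrow> f z = a * g z + b * h z"
  shows "frechet_derivative f (at y) v
    = a * frechet_derivative g (at y) v + b * frechet_derivative h (at y) v"
proof -
  have "((\<lambda>z. a * g z + b * h z) has_derivative
      (\<lambda>v. a * frechet_derivative g (at y) v + b * frechet_derivative h (at y) v)) (at y)"
    using assms(3,4) unfolding frechet_derivative_works
    by (intro has_derivative_add has_derivative_mult_right)
  then have "(f has_derivative
      (\<lambda>v. a * frechet_derivative g (at y) v + b * frechet_derivative h (at y) v)) (at y)"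
    using assms by (elim has_derivative_transform_within_open) auto
  from frechet_derivative_at[OF this, THEN fun_cong, of v] show ?thesis by simp
qed

section \<open>Smooth forms and coframes in a single chart\<close>

definition smooth_form :: "(real^7) set \<Rightarrow> nat \<Rightarrow> (real^7 \<Rightarrow> (real^7) ext_form) \<Rightarrow> bool" where
  "smooth_form U k \<omega> \<longleftrightarrow>
     (\<forall>y\<in>U. alternating_form k (\<omega> y)) \<and> (\<forall>vs. Cinf_on U (\<lambda>y. \<omega> y vs))"

lemma smooth_form_alternating: "smooth_form U k \<omega> \<Longrightarrow> y \<in> U \<Longrightarrow> alternating_form k (\<omega> y)"
  by (simp add: smooth_form_def)

lemma smooth_form_differentiable:
  "smooth_form U k \<omega> \<Longrightarrow> y \<in> U \<Longrightarrow> (\<lambda>y. \<omega> y vs) differentiable at y"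
  unfolding smooth_form_def by (blast intro: Cinf_on_differentiable)

lemma smooth_form_cong:
  assumes "open U" "\<And>y. y \<in> U \<Longrightarrow> \<omega> y = \<eta> y" "smooth_form U k \<omega>"
  shows "smooth_form U k \<eta>"
  unfolding smooth_form_def
proof (intro conjI ballI allI)
  show "Cinf_on U (\<lambda>y. \<eta> y vs)" for vs
  proof (rule Cinf_on_cong[OF assms(1)])
    show "Cinf_on U (\<lambda>y. \<omega> y vs)" using assms(3) by (simp add: smooth_form_def)
  qed (simp add: assms(2))
  show "alternating_form k (\<eta> y)" if "y \<in> U" for y
    using smooth_form_alternating[OF assms(3) that] assms(2)[OF that] by simp
qed

lemma smooth_form_scale: "smooth_form U k \<omega> \<Longrightarrow> smooth_form U k (\<lambda>y vs. r * \<omega> y vs)"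
  unfolding smooth_form_def
  by (intro conjI ballI allI alternating_form_scale Cinf_on_mult[OF Cinf_on_const]) simp_all

lemma smooth_form_add:
  "smooth_form U k \<omega> \<Longrightarrow> smooth_form U k \<eta> \<Longrightarrow> smooth_form U k (\<lambda>y vs. \<omega> y vs + \<eta> y vs)"
  unfolding smooth_form_def by (intro conjI ballI allI alternating_form_add Cinf_on_add) simp_all

lemma smooth_form_wedge:
  assumes "open U" "smooth_form U 1 \<alpha>" "smooth_form U k \<beta>"
  shows "smooth_form U (Suc k) (\<lambda>y. \<alpha> y \<^bold>\<and> \<beta> y)"
  unfolding smooth_form_def
proof (intro conjI ballI allI)
  fix vs
  have "Cinf_on U (\<lambda>y. \<Sum>i<length vs.
      (-1) ^ i * (\<alpha> y [vs ! i] * \<beta> y (take i vs @ drop (Suc i) vs)))"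
    using assms(2,3) unfolding smooth_form_def
    by (intro Cinf_on_sum Cinf_on_mult Cinf_on_const) auto
  then show "Cinf_on U (\<lambda>y. (\<alpha> y \<^bold>\<and> \<beta> y) vs)"
    using assms(2) by (elim Cinf_on_cong[OF assms(1), rotated])
      (simp add: wedge_covector smooth_form_alternating del: One_nat_def)
qed (use assms in \<open>auto intro: alternating_form_wedge smooth_form_alternating simp del: One_nat_def\<close>)

text \<open>\<open>smooth_form\<close> speaks of constant arguments. Smoothly varying ones are
  expanded in the coordinate axes, one at a time from the right; this is what makes evaluation on
  the dual vectors of a moving coframe smooth.\<close>

lemma smooth_form_apply:
  assumes "open U" "smooth_form U k \<omega>" "\<forall>f\<in>set fs. \<forall>i. Cinf_on U (\<lambda>y. f y $ i)"
  shows "Cinf_on U (\<lambda>y. \<omega> y (map (\<lambda>f. f y) fs @ vs))"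
  using assms(3)
proof (induction fs arbitrary: vs rule: rev_induct)
  case Nil
  then show ?case using assms(2) by (simp add: smooth_form_def)
next
  case (snoc f fs)
  have "Cinf_on U (\<lambda>y. \<Sum>i\<in>UNIV. f y $ i * \<omega> y (map (\<lambda>f. f y) fs @ axis i 1 # vs))"
    using snoc by (intro Cinf_on_sum Cinf_on_mult) auto
  then show ?case
  proof (rule Cinf_on_cong[OF assms(1), rotated])
    fix y assume "y \<in> U"
    then have "linear (\<lambda>v. \<omega> y (map (\<lambda>f. f y) fs @ v # vs))"
      by (intro alternating_form_linear[OF smooth_form_alternating[OF assms(2)]])
    from linear_axis_expansion[OF this, of "f y"]
    show "(\<Sum>i\<in>UNIV. f y $ i * \<omega> y (map (\<lambda>f. f y) fs @ axis i 1 # vs))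
      = \<omega> y (map (\<lambda>f. f y) (fs @ [f]) @ vs)" by simp
  qed
qed

definition smooth_coframe :: "(real^7) set \<Rightarrow> (nat \<Rightarrow> real^7 \<Rightarrow> (real^7) ext_form) \<Rightarrow> bool" where
  "smooth_coframe U x \<longleftrightarrow>
     (\<forall>i\<in>{1..7}. smooth_form U 1 (x i)) \<and> (\<forall>y\<in>U. coframe (\<lambda>i. x i y))"

lemma Cinf_on_dual_vector:
  assumes "open U" "smooth_coframe U x"
  shows "Cinf_on U (\<lambda>y. dual_vector (\<lambda>i. x i y) j $ k)"
proof -
  let ?M = "\<lambda>y. coframe_matrix (\<lambda>i. x i y)"
  have M: "Cinf_on U (\<lambda>y. ?M y $ i $ l)" for i l
    using assms(2) index_in[of i] by (simp add: coframe_matrix_def smooth_coframe_def smooth_form_def)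
  have "Cinf_on U (\<lambda>y. det (\<chi> i l. if l = k then if coframe_index i = j then 1 else 0 else ?M y $ i $ l)
      / det (?M y))"
  proof (intro Cinf_on_divide Cinf_on_det M ballI)
    show "Cinf_on U (\<lambda>y. (\<chi> i l. if l = k then if coframe_index i = j then 1 else 0 else ?M y $ i $ l) $ i $ l)"
      for i l using M[of i l] by (cases "l = k") (simp_all add: Cinf_on_const)
    show "det (?M y) \<noteq> 0" if "y \<in> U" for y
      using that assms(2) by (simp add: coframe_det smooth_coframe_def)
  qed
  then show ?thesis
    using assms(2) by (elim Cinf_on_cong[OF assms(1), rotated])
      (simp add: dual_vector_cramer smooth_coframe_def)
qed

lemma smooth_volume_form:
  assumes "open U" "smooth_coframe U x"
  shows "smooth_form U 7 (\<lambda>y. volume_form (\<lambda>i. x i y))"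
proof -
  have "smooth_form U (Suc (Suc (Suc (Suc (Suc (Suc 1)))))) (\<lambda>y. volume_form (\<lambda>i. x i y))"
    unfolding volume_form_def using assms(2)
    by (intro smooth_form_wedge[OF assms(1)]) (auto simp: smooth_coframe_def)
  then show ?thesis by (simp add: eval_nat_numeral)
qed

lemma smooth_form_hodge:
  assumes "open U" "smooth_coframe U x" "smooth_form U k \<omega>" "k \<le> 7"
  shows "smooth_form U (7 - k) (\<lambda>y. hodge (\<lambda>i. x i y) (\<omega> y))"
  unfolding smooth_form_def
proof (intro conjI ballI allI)
  fix y assume "y \<in> U"
  then show "alternating_form (7 - k) (hodge (\<lambda>i. x i y) (\<omega> y))"
    using assms by (intro alternating_form_hodge) (auto simp: smooth_form_def smooth_coframe_def)
next
  fix vs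
  have "Cinf_on U (\<lambda>y. \<eta> y (dual_vectors (\<lambda>i. x i y) I @ vs))" if "smooth_form U n \<eta>" for \<eta> n I vs
    using smooth_form_apply[OF assms(1) that,
        of "map (\<lambda>j y. dual_vector (\<lambda>i. x i y) j) (sorted_list_of_set I)"]
    by (simp add: Cinf_on_dual_vector[OF assms(1,2)] dual_vectors_def comp_def)
  note this[OF assms(3), of _ "[]", simplified] this[OF smooth_volume_form[OF assms(1,2)]]
  then show "Cinf_on U (\<lambda>y. hodge (\<lambda>i. x i y) (\<omega> y) vs)"
    unfolding hodge_def by (intro Cinf_on_sum Cinf_on_mult)
qed

text \<open>Pointwise linear relations between values of \<omega> persist under differentiation, so
  each directional derivative is again alternating of degree \<open>k\<close>, and it is linear in
  the direction. Alternation over the direction raises the degree by one.\<close>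

lemma smooth_form_ext_deriv:
  assumes "open U" "smooth_form U k (\<omega> c)"
  shows "smooth_form U (Suc k) (ext_deriv \<omega> c)"
  unfolding smooth_form_def
proof (intro conjI ballI allI)
  fix vs
  show "Cinf_on U (\<lambda>y. ext_deriv \<omega> c y vs)"
    using assms unfolding ext_deriv_def smooth_form_def
    by (intro Cinf_on_sum Cinf_on_mult Cinf_on_const Cinf_on_frechet_derivative) auto
next
  fix y assume y: "y \<in> U"
  let ?F = "\<lambda>v ws. frechet_derivative (\<lambda>z. \<omega> c z ws) (at y) v"
  have d: "(\<lambda>z. \<omega> c z ws) differentiable at y" for ws
    by (rule smooth_form_differentiable[OF assms(2) y])
  \<comment> \<open>With both coefficients 0 this also shows that derivatives vanish; the argument
    list \<open>[]\<close> then merely fills a place.\<close>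
  note comb = frechet_derivative_combination[OF assms(1) y d d]
  have alt: "alternating_form k (\<omega> c z)" if "z \<in> U" for z
    using assms(2) that by (rule smooth_form_alternating)
  have "alternating_form k (?F v)" for v
  proof (rule alternating_formI)
    show "?F v ws = 0" if "length ws \<noteq> k" for ws
      using comb[of "\<lambda>z. \<omega> c z ws" 0 "[]" 0 "[]"] that by (simp add: alternating_form_length[OF alt])
    show "?F v ws = 0" if "\<not> distinct ws" for ws
      using comb[of "\<lambda>z. \<omega> c z ws" 0 "[]" 0 "[]"] that by (simp add: alternating_form_not_distinct[OF alt])
    show "linear (\<lambda>w. ?F v (a @ w # b))" for a b
    proof (rule linearI)
      fix w1 w2 and r :: real
      show "?F v (a @ (w1 + w2) # b) = ?F v (a @ w1 # b) + ?F v (a @ w2 # b)"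
        using comb[of "\<lambda>z. \<omega> c z (a @ (w1 + w2) # b)" 1 "a @ w1 # b" 1 "a @ w2 # b" v]
        by (simp add: linear_add[OF alternating_form_linear[OF alt, of _ a b]])
      show "?F v (a @ r *\<^sub>R w1 # b) = r *\<^sub>R ?F v (a @ w1 # b)"
        using comb[of "\<lambda>z. \<omega> c z (a @ r *\<^sub>R w1 # b)" r "a @ w1 # b" 0 "[]" v]
        by (simp add: linear_scale[OF alternating_form_linear[OF alt, of _ a b]])
    qed
  qed
  moreover have "linear (\<lambda>v. ?F v ws)" for ws
    by (rule linear_frechet_derivative[OF d])
  ultimately show "alternating_form (Suc k) (ext_deriv \<omega> c y)"
    using alternating_form_alternation[of k ?F] by (simp add: ext_deriv_def[abs_def])
qed

lemma ext_deriv_combination: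
  assumes "open U" "y \<in> U" "smooth_form U k (\<omega> c)" "smooth_form U l (\<eta> c)"
    and "\<And>z. z \<in> U \<Longrightarrow> \<zeta> c z = (\<lambda>vs. a * \<omega> c z vs + b * \<eta> c z vs)"
  shows "ext_deriv \<zeta> c y vs = a * ext_deriv \<omega> c y vs + b * ext_deriv \<eta> c y vs"
proof -
  have "frechet_derivative (\<lambda>z. \<zeta> c z ws) (at y) v
    = a * frechet_derivative (\<lambda>z. \<omega> c z ws) (at y) v
      + b * frechet_derivative (\<lambda>z. \<eta> c z ws) (at y) v" for ws v
    using assms(5)
    by (intro frechet_derivative_combination[OF assms(1,2)] smooth_form_differentiable[OF assms(3)]
        smooth_form_differentiable[OF assms(4)] assms(2)) auto
  then show ?thesis
    by (simp add: ext_deriv_def sum_distrib_left sum.distrib[symmetric] algebra_simps)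
qed

section \<open>The Hodge Laplacian\<close>

lemma ext_deriv_scale:
  assumes "open U" "y \<in> U" "smooth_form U k (\<omega> c)"
    and "\<And>z. z \<in> U \<Longrightarrow> \<eta> c z = (\<lambda>vs. a * \<omega> c z vs)"
  shows "ext_deriv \<eta> c y = (\<lambda>vs. a * ext_deriv \<omega> c y vs)"
  using ext_deriv_combination[where \<omega> = \<omega> and \<eta> = \<omega> and \<zeta> = \<eta> and c = c and a = a and b = 0,
      OF assms(1,2,3,3)] assms(4) by auto

lemma ext_deriv_cong:
  assumes "open U" "y \<in> U" "smooth_form U k (\<omega> c)" "\<And>z. z \<in> U \<Longrightarrow> \<eta> c z = \<omega> c z"
  shows "ext_deriv \<eta> c y = ext_deriv \<omega> c y"
  using ext_deriv_scale[where \<omega> = \<omega> and \<eta> = \<eta> and c = c and a = 1, OF assms(1-3)] assms(4) by simp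

context
  fixes U :: "(real^7) set" and x :: "nat \<Rightarrow> 's dform" and c :: "'s chart"
  assumes U: "open U" and x: "smooth_coframe U (\<lambda>i. x i c)"
begin

lemma smooth_form_star:
  assumes "smooth_form U k (\<omega> c)" "k \<le> 7"
  shows "smooth_form U (7 - k) (star x \<omega> c)"
  using smooth_form_hodge[OF U x assms] by (simp add: star_def[abs_def])

lemma star_star:
  assumes "smooth_form U k (\<omega> c)" "k \<le> 7" "y \<in> U"
  shows "star x (star x \<omega>) c y = \<omega> c y"
  using assms x unfolding star_def
  by (intro hodge_hodge[OF _ smooth_form_alternating]) (auto simp: smooth_coframe_def)

text \<open>\<open>codiff\<close> reads its sign off the number of arguments. On a form of degree
  \<open>k\<close> the result is nonzero only on lists of length \<open>k - 1\<close>, so the sign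
  becomes the constant (-1)^k.\<close>

lemma codiff_eq:
  assumes "smooth_form U k (\<omega> c)" "0 < k" "k \<le> 7" "y \<in> U"
  shows "codiff x \<omega> c y = (\<lambda>vs. (-1) ^ k * star x (ext_deriv (star x \<omega>)) c y vs)"
proof
  fix vs
  have "smooth_form U (7 - Suc (7 - k)) (star x (ext_deriv (star x \<omega>)) c)"
    using assms by (intro smooth_form_star smooth_form_ext_deriv U) auto
  then have "star x (ext_deriv (star x \<omega>)) c y vs = 0" if "length vs \<noteq> k - 1"
    using that assms by (intro alternating_form_length[OF smooth_form_alternating]) auto
  then show "codiff x \<omega> c y vs = (-1) ^ k * star x (ext_deriv (star x \<omega>)) c y vs"
    using assms(2) by (cases "length vs = k - 1") (auto simp: codiff_def)
qed

lemma smooth_form_codiff: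
  assumes "smooth_form U k (\<omega> c)" "0 < k" "k \<le> 7"
  shows "smooth_form U (k - 1) (codiff x \<omega> c)"
proof (rule smooth_form_cong[OF U])
  have "smooth_form U (7 - Suc (7 - k)) (star x (ext_deriv (star x \<omega>)) c)"
    using assms by (intro smooth_form_star smooth_form_ext_deriv U) auto
  moreover have "7 - Suc (7 - k) = k - 1" using assms by simp
  ultimately show "smooth_form U (k - 1) (\<lambda>y vs. (-1) ^ k * star x (ext_deriv (star x \<omega>)) c y vs)"
    by (simp add: smooth_form_scale)
qed (simp add: codiff_eq[of k] assms)

lemma smooth_form_hodge_laplacian:
  assumes "smooth_form U k (\<omega> c)" "0 < k" "k < 7"
  shows "smooth_form U k (hodge_laplacian x \<omega> c)"
proof -
  have "smooth_form U (Suc (k - 1)) (ext_deriv (codiff x \<omega>) c)"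
    using assms by (intro smooth_form_ext_deriv smooth_form_codiff U) auto
  moreover have "smooth_form U (Suc k - 1) (codiff x (ext_deriv \<omega>) c)"
    using assms by (intro smooth_form_ext_deriv smooth_form_codiff U) auto
  ultimately show ?thesis
    using assms(2) smooth_form_add by (simp add: hodge_laplacian_def[abs_def])
qed

text \<open>With S the star and S S = id, the Laplacian in degree k is (-1)^k d S d S - (-1)^k S d S
  d. Composing with S on either side gives the same two operators S d S d S and d S d, and their
  signs agree because k and 7 - k have opposite parity.\<close>

lemma hodge_laplacian_star:
  assumes \<omega>: "smooth_form U k (\<omega> c)" and k: "0 < k" "k < 7" and y: "y \<in> U"
  shows "hodge_laplacian x (star x \<omega>) c y = star x (hodge_laplacian x \<omega>) c y"
proof
  fix vs
  let ?S = "star x" and ?d = "ext_deriv"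
  let ?a = "?S (?d (?S (?d (?S \<omega>))))" and ?b = "?d (?S (?d \<omega>))"
  have deg: "Suc (7 - k) = 8 - k" "Suc (6 - k) = 7 - k" "7 - (8 - k) = k - 1" "7 - Suc k = 6 - k"
    "8 - k \<le> 7" "Suc k \<le> 7"
    using k by auto
  have S\<omega>: "smooth_form U (7 - k) (?S \<omega> c)" using \<omega> k by (intro smooth_form_star) auto
  have d\<omega>: "smooth_form U (Suc k) (?d \<omega> c)" using \<omega> by (intro smooth_form_ext_deriv U)
  have dS\<omega>: "smooth_form U (8 - k) (?d (?S \<omega>) c)"
    using smooth_form_ext_deriv[where \<omega> = "?S \<omega>", OF U S\<omega>] deg by simp
  have SdS\<omega>: "smooth_form U (k - 1) (?S (?d (?S \<omega>)) c)"
    using smooth_form_star[where \<omega> = "?d (?S \<omega>)", OF dS\<omega>] deg by simp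
  have Sd\<omega>: "smooth_form U (6 - k) (?S (?d \<omega>) c)"
    using smooth_form_star[where \<omega> = "?d \<omega>", OF d\<omega>] deg by simp
  have dSd\<omega>: "smooth_form U (7 - k) (?b c)"
    using smooth_form_ext_deriv[where \<omega> = "?S (?d \<omega>)", OF U Sd\<omega>] deg by simp
  have "codiff x (?S \<omega>) c z = (\<lambda>vs. (-1) ^ (7 - k) * ?S (?d \<omega>) c z vs)" if z: "z \<in> U" for z
  proof -
    \<comment> \<open>The double star is known to be the identity only on \<open>U\<close>, hence
      the local congruence rule for the exterior derivative.\<close>
    have "?d (?S (?S \<omega>)) c z = ?d \<omega> c z"
      using \<omega> k z by (intro ext_deriv_cong[OF U] star_star) auto
    then show ?thesis using codiff_eq[where \<omega> = "?S \<omega>", OF S\<omega> _ _ z] k by (simp add: star_def)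
  qed
  then have 1: "?d (codiff x (?S \<omega>)) c y vs = (-1) ^ (7 - k) * ?b c y vs"
    by (simp add: ext_deriv_scale[where \<omega> = "?S (?d \<omega>)" and c = c, OF U y Sd\<omega>])
  have 2: "codiff x (?d (?S \<omega>)) c y vs = (-1) ^ (8 - k) * ?a c y vs"
    using codiff_eq[where \<omega> = "?d (?S \<omega>)", OF dS\<omega> _ _ y] k by simp
  have 3: "?d (codiff x \<omega>) c y = (\<lambda>vs. (-1) ^ k * ?d (?S (?d (?S \<omega>))) c y vs)"
    using codiff_eq[where \<omega> = \<omega>, OF \<omega>] k
    by (intro ext_deriv_scale[where \<omega> = "?S (?d (?S \<omega>))", OF U y SdS\<omega>]) auto
  have 4: "codiff x (?d \<omega>) c y = (\<lambda>vs. (-1) ^ Suc k * ?S ?b c y vs)"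
    using codiff_eq[where \<omega> = "?d \<omega>", OF d\<omega> _ _ y] k by simp
  have *: "hodge_laplacian x \<omega> c y
      = (\<lambda>vs. (-1) ^ k * ?d (?S (?d (?S \<omega>))) c y vs + (-1) ^ Suc k * ?S ?b c y vs)"
    by (simp add: fun_eq_iff hodge_laplacian_def 3 4)
  have "?S (hodge_laplacian x \<omega>) c y vs = (-1) ^ k * ?a c y vs + (-1) ^ Suc k * ?S (?S ?b) c y vs"
    unfolding star_def[of x "hodge_laplacian x \<omega>"] * hodge_linear
    by (simp add: star_def)
  also have "?S (?S ?b) c y = ?b c y" by (rule star_star[where \<omega> = ?b, OF dSd\<omega> _ y]) simp
  also have "(-1) ^ k = ((-1) ^ (8 - k) :: real)" using k by (simp add: uminus_power_if)
  also have "(-1) ^ Suc k = ((-1) ^ (7 - k) :: real)" using k by (simp add: uminus_power_if)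
  finally show "hodge_laplacian x (?S \<omega>) c y vs = ?S (hodge_laplacian x \<omega>) c y vs"
    by (simp only: hodge_laplacian_def[of x "?S \<omega>"] 1 2 add.commute)
qed

end

section \<open>The Laplacian under a homothety\<close>

context
  fixes U :: "(real^7) set" and x x' :: "nat \<Rightarrow> 's dform" and c :: "'s chart" and r :: real
  assumes U: "open U" and x: "smooth_coframe U (\<lambda>i. x i c)" and r: "r \<noteq> 0"
    and xx': "\<And>i y. i \<in> {1..7} \<Longrightarrow> y \<in> U \<Longrightarrow> x' i c y = (\<lambda>vs. r * x i c y vs)"
begin

lemma smooth_coframe_homothety: "smooth_coframe U (\<lambda>i. x' i c)"
  unfolding smooth_coframe_def
proof (intro conjI ballI)
  fix i :: nat assume i: "i \<in> {1..7}"
  show "smooth_form U 1 (x' i c)"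
  proof (rule smooth_form_cong[OF U])
    show "smooth_form U 1 (\<lambda>y vs. r * x i c y vs)"
      using x i unfolding smooth_coframe_def by (intro smooth_form_scale) blast
  qed (simp add: xx'[OF i])
next
  fix y assume y: "y \<in> U"
  then have "coframe (\<lambda>i. x i c y)" using x by (simp add: smooth_coframe_def)
  then show "coframe (\<lambda>i. x' i c y)"
    by (rule coframe_scale[where r = "\<lambda>_. r"]) (simp_all add: r xx' y)
qed

lemma star_homothety:
  assumes "smooth_form U k (\<omega> c)" "y \<in> U" "\<omega>' c y = (\<lambda>vs. q * \<omega> c y vs)"
  shows "star x' \<omega>' c y = (\<lambda>vs. (q * r ^ 7 / r ^ (2 * k)) * star x \<omega> c y vs)"
proof
  fix vs
  have "star x' \<omega>' c y vs = r ^ 7 / r ^ (2 * k) * hodge (\<lambda>i. x i c y) (\<omega>' c y) vs"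
    unfolding star_def using assms x r xx'
    by (intro hodge_homothety) (auto simp: smooth_coframe_def smooth_form_def alternating_form_scale)
  also have "hodge (\<lambda>i. x i c y) (\<omega>' c y) vs = q * star x \<omega> c y vs"
    by (simp add: assms(3) star_def hodge_def sum_distrib_left mult.assoc)
  finally show "star x' \<omega>' c y vs = (q * r ^ 7 / r ^ (2 * k)) * star x \<omega> c y vs" by simp
qed

text \<open>The two stars act in degrees k and 8 - k and contribute r^(7 - 2k) and r^(7 - 2(8 - k)).
  The degree drops out of the product, which is r^(-2).\<close>

lemma codiff_homothety:
  assumes \<omega>: "smooth_form U k (\<omega> c)" and k: "0 < k" "k \<le> 7" and y: "y \<in> U"
    and \<omega>': "\<And>y. y \<in> U \<Longrightarrow> \<omega>' c y = (\<lambda>vs. q * \<omega> c y vs)"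
  shows "codiff x' \<omega>' c y = (\<lambda>vs. q / r\<^sup>2 * codiff x \<omega> c y vs)"
proof -
  have smooth': "smooth_form U k (\<omega>' c)"
    using \<omega>' by (intro smooth_form_cong[OF U _ smooth_form_scale[OF \<omega>, of q]]) simp
  have S\<omega>: "smooth_form U (7 - k) (star x \<omega> c)"
    using \<omega> k by (intro smooth_form_star[where x = x and c = c, OF U x])
  have "star x' \<omega>' c z = (\<lambda>vs. (q * r ^ 7 / r ^ (2 * k)) * star x \<omega> c z vs)" if "z \<in> U" for z
    by (rule star_homothety[where \<omega> = \<omega> and \<omega>' = \<omega>', OF \<omega> that \<omega>'[OF that]])
  then have "ext_deriv (star x' \<omega>') c y
      = (\<lambda>vs. (q * r ^ 7 / r ^ (2 * k)) * ext_deriv (star x \<omega>) c y vs)"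
    by (rule ext_deriv_scale[where \<omega> = "star x \<omega>", OF U y S\<omega>])
  then have *: "star x' (ext_deriv (star x' \<omega>')) c y
      = (\<lambda>vs. (q * r ^ 7 / r ^ (2 * k) * r ^ 7 / r ^ (2 * Suc (7 - k)))
          * star x (ext_deriv (star x \<omega>)) c y vs)"
    by (rule star_homothety[where \<omega> = "ext_deriv (star x \<omega>)", OF smooth_form_ext_deriv[where \<omega> = "star x \<omega>", OF U S\<omega>] y])
  have "r ^ (2 * k) * r ^ (2 * Suc (7 - k)) = r ^ (7 + 7 + 2)"
    unfolding power_add[symmetric] using k by (intro arg_cong[of _ _ "power r"]) simp
  then have "q * r ^ 7 / r ^ (2 * k) * r ^ 7 / r ^ (2 * Suc (7 - k)) = q * (r ^ 7 * r ^ 7) / r ^ (7 + 7 + 2)"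
    by (simp only: divide_divide_eq_left times_divide_eq_left mult.assoc)
  also have "\<dots> = q / r\<^sup>2" using r by (simp add: divide_simps flip: power_add)
  finally show ?thesis
    unfolding codiff_eq[where \<omega> = \<omega> and x = x and c = c, OF U x \<omega> k y]
      codiff_eq[where \<omega> = \<omega>' and x = x' and c = c, OF U smooth_coframe_homothety smooth' k y] *
    by (simp add: mult.left_commute)
qed

lemma hodge_laplacian_homothety:
  assumes \<omega>: "smooth_form U k (\<omega> c)" and k: "0 < k" "k < 7" and y: "y \<in> U"
    and \<omega>': "\<And>y. y \<in> U \<Longrightarrow> \<omega>' c y = (\<lambda>vs. q * \<omega> c y vs)"
  shows "hodge_laplacian x' \<omega>' c y vs = q / r\<^sup>2 * hodge_laplacian x \<omega> c y vs"
proof -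
  have "ext_deriv \<omega>' c z = (\<lambda>vs. q * ext_deriv \<omega> c z vs)" if "z \<in> U" for z
    using \<omega>' by (intro ext_deriv_scale[where \<omega> = \<omega>, OF U that \<omega>])
  then have "codiff x' (ext_deriv \<omega>') c y = (\<lambda>vs. q / r\<^sup>2 * codiff x (ext_deriv \<omega>) c y vs)"
    using k by (intro codiff_homothety[where \<omega> = "ext_deriv \<omega>", OF smooth_form_ext_deriv[where \<omega> = \<omega>, OF U \<omega>] _ _ y]) auto
  moreover have "codiff x' \<omega>' c z = (\<lambda>vs. q / r\<^sup>2 * codiff x \<omega> c z vs)" if "z \<in> U" for z
    using k by (intro codiff_homothety[where \<omega> = \<omega> and \<omega>' = \<omega>', OF \<omega> _ _ that] \<omega>') auto
  then have "ext_deriv (codiff x' \<omega>') c y = (\<lambda>vs. q / r\<^sup>2 * ext_deriv (codiff x \<omega>) c y vs)"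
    using k by (intro ext_deriv_scale[where \<omega> = "codiff x \<omega>", OF U y smooth_form_codiff[where \<omega> = \<omega> and x = x and c = c, OF U x \<omega>]]) auto
  ultimately show ?thesis by (simp add: hodge_laplacian_def distrib_left)
qed

end

section \<open>Weighted G2-forms and power coframes\<close>

text \<open>The weights keep track of time derivatives: on power coframes, both the G2-form and its dual are
  differentiated by multiplying each term by its exponent.\<close>

definition weighted_g2_form ::
    "(nat \<Rightarrow> nat \<Rightarrow> nat \<Rightarrow> real) \<Rightarrow> (nat \<Rightarrow> (real^7) ext_form) \<Rightarrow> (real^7) ext_form" where
  "weighted_g2_form w x vs =
     w 1 2 7 * (x 1 \<^bold>\<and> x 2 \<^bold>\<and> x 7) vs + w 3 4 7 * (x 3 \<^bold>\<and> x 4 \<^bold>\<and> x 7) vs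
     + w 5 6 7 * (x 5 \<^bold>\<and> x 6 \<^bold>\<and> x 7) vs + w 1 3 5 * (x 1 \<^bold>\<and> x 3 \<^bold>\<and> x 5) vs
     - w 1 4 6 * (x 1 \<^bold>\<and> x 4 \<^bold>\<and> x 6) vs - w 2 3 6 * (x 2 \<^bold>\<and> x 3 \<^bold>\<and> x 6) vs
     - w 2 4 5 * (x 2 \<^bold>\<and> x 4 \<^bold>\<and> x 5) vs"

lemma g2_form_eq_weighted: "g2_form x = weighted_g2_form (\<lambda>_ _ _. 1) x"
  by (simp add: fun_eq_iff g2_form_def weighted_g2_form_def)

lemma index_mems: "1 \<in> {1..7::nat}" "2 \<in> {1..7::nat}" "3 \<in> {1..7::nat}" "4 \<in> {1..7::nat}"
    "5 \<in> {1..7::nat}" "6 \<in> {1..7::nat}" "7 \<in> {1..7::nat}"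
  by auto

lemma weighted_g2_form_cong:
  assumes "\<And>i j k. i \<in> {1..7} \<Longrightarrow> j \<in> {1..7} \<Longrightarrow> k \<in> {1..7} \<Longrightarrow> w i j k = w' i j k"
  shows "weighted_g2_form w x = weighted_g2_form w' x"
  by (simp only: fun_eq_iff weighted_g2_form_def assms index_mems simp_thms)

lemma weighted_g2_form_times:
  "weighted_g2_form (\<lambda>i j k. a * w i j k) x = (\<lambda>vs. a * weighted_g2_form w x vs)"
  by (simp add: fun_eq_iff weighted_g2_form_def algebra_simps)

lemma weighted_g2_form_scale:
  assumes "\<And>i. i \<in> {1..7} \<Longrightarrow> y i = (\<lambda>vs. r i * x i vs)"
  shows "weighted_g2_form w y = weighted_g2_form (\<lambda>i j k. w i j k * (r i * r j * r k)) x"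
  by (simp only: fun_eq_iff weighted_g2_form_def assms[OF index_mems(1)] assms[OF index_mems(2)]
      assms[OF index_mems(3)] assms[OF index_mems(4)] assms[OF index_mems(5)]
      assms[OF index_mems(6)] assms[OF index_mems(7)] wedge_scale mult.assoc simp_thms)

lemma weighted_g2_form_homothety:
  assumes "\<And>i. i \<in> {1..7} \<Longrightarrow> y i = (\<lambda>vs. r * x i vs)"
  shows "weighted_g2_form w y = (\<lambda>vs. r ^ 3 * weighted_g2_form w x vs)"
proof -
  have "weighted_g2_form w y = weighted_g2_form (\<lambda>i j k. w i j k * (r * r * r)) x"
    by (rule weighted_g2_form_scale) (rule assms)
  also have "\<dots> = weighted_g2_form (\<lambda>i j k. r ^ 3 * w i j k) x"
    by (simp add: power3_eq_cube mult.commute)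
  finally show ?thesis by (simp only: weighted_g2_form_times)
qed

lemma g2_form_homothety:
  assumes "\<And>i. i \<in> {1..7} \<Longrightarrow> y i = (\<lambda>vs. r * x i vs)"
  shows "g2_form y = (\<lambda>vs. r ^ 3 * g2_form x vs)"
  unfolding g2_form_eq_weighted using assms by (rule weighted_g2_form_homothety)

lemma hodge_weighted_g2_form:
  "hodge x (weighted_g2_form w y) vs =
     w 1 2 7 * hodge x (y 1 \<^bold>\<and> y 2 \<^bold>\<and> y 7) vs + w 3 4 7 * hodge x (y 3 \<^bold>\<and> y 4 \<^bold>\<and> y 7) vs
     + w 5 6 7 * hodge x (y 5 \<^bold>\<and> y 6 \<^bold>\<and> y 7) vs + w 1 3 5 * hodge x (y 1 \<^bold>\<and> y 3 \<^bold>\<and> y 5) vs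
     - w 1 4 6 * hodge x (y 1 \<^bold>\<and> y 4 \<^bold>\<and> y 6) vs - w 2 3 6 * hodge x (y 2 \<^bold>\<and> y 3 \<^bold>\<and> y 6) vs
     - w 2 4 5 * hodge x (y 2 \<^bold>\<and> y 4 \<^bold>\<and> y 5) vs"
  unfolding hodge_def weighted_g2_form_def sum_distrib_left sum.distrib[symmetric] sum_subtractf[symmetric]
  by (intro sum.cong refl) (simp only: distrib_right left_diff_distrib mult.assoc)

text \<open>A term of the 3-form scales with its three indices, its dual with the four complementary
  ones. This is the source of the exponents \<open>(\<Sum>i=1..7. b i) - (b i + b j + b k)\<close>
  of the dual 4-form.\<close>

lemma hodge_weighted_g2_form_scale:
  assumes x: "coframe x" and r: "\<And>i. i \<in> {1..7} \<Longrightarrow> r i \<noteq> 0"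
    and y: "\<And>i. i \<in> {1..7} \<Longrightarrow> y i = (\<lambda>vs. r i * x i vs)"
  shows "hodge y (weighted_g2_form w y) =
    hodge x (weighted_g2_form (\<lambda>i j k. w i j k * ((\<Prod>i=1..7. r i) / (r i * r j * r k))) x)"
proof
  fix vs
  note h = hodge_scale_wedge3[where x = x and y = y and r = r, OF x r y]
  have w: "hodge y (y i \<^bold>\<and> y j \<^bold>\<and> y k) vs
      = (\<Prod>i=1..7. r i) / (r i * r j * r k) * hodge x (x i \<^bold>\<and> x j \<^bold>\<and> x k) vs"
    if "i \<in> {1..7}" "j \<in> {1..7}" "k \<in> {1..7}" "i \<noteq> j" "i \<noteq> k" "j \<noteq> k" for i j k
    using that by (intro h) auto
  have *: "hodge y (y 1 \<^bold>\<and> y 2 \<^bold>\<and> y 7) vs = (\<Prod>i=1..7. r i) / (r 1 * r 2 * r 7) * hodge x (x 1 \<^bold>\<and> x 2 \<^bold>\<and> x 7) vs"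
    "hodge y (y 3 \<^bold>\<and> y 4 \<^bold>\<and> y 7) vs = (\<Prod>i=1..7. r i) / (r 3 * r 4 * r 7) * hodge x (x 3 \<^bold>\<and> x 4 \<^bold>\<and> x 7) vs"
    "hodge y (y 5 \<^bold>\<and> y 6 \<^bold>\<and> y 7) vs = (\<Prod>i=1..7. r i) / (r 5 * r 6 * r 7) * hodge x (x 5 \<^bold>\<and> x 6 \<^bold>\<and> x 7) vs"
    "hodge y (y 1 \<^bold>\<and> y 3 \<^bold>\<and> y 5) vs = (\<Prod>i=1..7. r i) / (r 1 * r 3 * r 5) * hodge x (x 1 \<^bold>\<and> x 3 \<^bold>\<and> x 5) vs"
    "hodge y (y 1 \<^bold>\<and> y 4 \<^bold>\<and> y 6) vs = (\<Prod>i=1..7. r i) / (r 1 * r 4 * r 6) * hodge x (x 1 \<^bold>\<and> x 4 \<^bold>\<and> x 6) vs"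
    "hodge y (y 2 \<^bold>\<and> y 3 \<^bold>\<and> y 6) vs = (\<Prod>i=1..7. r i) / (r 2 * r 3 * r 6) * hodge x (x 2 \<^bold>\<and> x 3 \<^bold>\<and> x 6) vs"
    "hodge y (y 2 \<^bold>\<and> y 4 \<^bold>\<and> y 5) vs = (\<Prod>i=1..7. r i) / (r 2 * r 4 * r 5) * hodge x (x 2 \<^bold>\<and> x 4 \<^bold>\<and> x 5) vs"
    by (rule w; simp)+
  show "hodge y (weighted_g2_form w y) vs =
    hodge x (weighted_g2_form (\<lambda>i j k. w i j k * ((\<Prod>i=1..7. r i) / (r i * r j * r k))) x) vs"
    unfolding hodge_weighted_g2_form * by (simp only: mult.assoc)
qed

lemma smooth_weighted_g2_form:
  assumes "open U" "smooth_coframe U x"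
  shows "smooth_form U 3 (\<lambda>y. weighted_g2_form w (\<lambda>i. x i y))"
proof -
  have s: "smooth_form U 3 (\<lambda>y vs. a * (x i y \<^bold>\<and> x j y \<^bold>\<and> x k y) vs)"
    if "i \<in> {1..7}" "j \<in> {1..7}" "k \<in> {1..7}" for a i j k
  proof -
    have "smooth_form U (Suc (Suc 1)) (\<lambda>y. x i y \<^bold>\<and> x j y \<^bold>\<and> x k y)"
      using assms(2) that unfolding smooth_coframe_def by (intro smooth_form_wedge[OF assms(1)]) auto
    then show ?thesis by (intro smooth_form_scale) (simp add: eval_nat_numeral)
  qed
  let ?f = "\<lambda>a i j k y vs. a * (x i y \<^bold>\<and> x j y \<^bold>\<and> x k y) vs"
  have "smooth_form U 3 (\<lambda>y vs. ?f (w 1 2 7) 1 2 7 y vs + (?f (w 3 4 7) 3 4 7 y vs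
      + (?f (w 5 6 7) 5 6 7 y vs + (?f (w 1 3 5) 1 3 5 y vs + (?f (- w 1 4 6) 1 4 6 y vs
      + (?f (- w 2 3 6) 2 3 6 y vs + ?f (- w 2 4 5) 2 4 5 y vs))))))"
    by (intro smooth_form_add s index_mems)
  then show ?thesis by (simp add: weighted_g2_form_def[abs_def] algebra_simps)
qed

section \<open>Time derivatives of power families\<close>

lemma deriv_power:
  fixes a p m t :: real
  assumes "1 - a * m\<^sup>2 * t > 0"
  shows "((\<lambda>s. (1 - a * m\<^sup>2 * s) powr p) has_real_derivative
    - (a * m\<^sup>2) / (1 - a * m\<^sup>2 * t) * (p * (1 - a * m\<^sup>2 * t) powr p)) (at t)"
proof -
  have "((\<lambda>s. 1 - a * m\<^sup>2 * s) has_real_derivative - (a * m\<^sup>2)) (at t)"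
    by (auto intro!: derivative_eq_intros)
  \<comment> \<open>\<open>powr_diff\<close> turns the power with exponent \<open>p - 1\<close> into
    the original power divided by the base, so a factor independent of \<open>p\<close> can be split
    off from all terms of a form.\<close>
  from DERIV_chain2[OF has_real_derivative_powr[OF assms, of p] this] show ?thesis
    using assms by (simp add: powr_diff mult_ac)
qed

lemma open_power_domain: "open (power_domain m a)"
  unfolding power_domain_def by (intro open_Collect_less continuous_intros)

context
  fixes e :: "nat \<Rightarrow> 's dform" and c :: "'s chart" and y :: "real^7" and m a :: real and b :: "nat \<Rightarrow> real"
  assumes e: "coframe (\<lambda>i. e i c y)"
begin

text \<open>With respect to the fixed coframe \<open>e\<close> all time dependence sits in scalar
  weights, so that differentiation in time is termwise.\<close>

lemma power_g2_eq_weighted: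
  assumes "t \<in> power_domain m a"
  shows "weighted_g2_form w (\<lambda>i. power_coframe m a b e t i c y) =
    weighted_g2_form (\<lambda>i j k. w i j k * (1 - a * m\<^sup>2 * t) powr (b i + b j + b k)) (\<lambda>i. e i c y)"
  by (subst weighted_g2_form_scale[where r = "\<lambda>i. (1 - a * m\<^sup>2 * t) powr b i" and x = "\<lambda>i. e i c y"])
    (simp_all add: power_coframe_def scale_form_def[abs_def] powr_add)

lemma hodge_power_g2_eq_weighted:
  assumes "t \<in> power_domain m a"
  shows "hodge (\<lambda>i. power_coframe m a b e t i c y)
      (weighted_g2_form w (\<lambda>i. power_coframe m a b e t i c y)) =
    hodge (\<lambda>i. e i c y) (weighted_g2_form (\<lambda>i j k. w i j k *
      (1 - a * m\<^sup>2 * t) powr ((\<Sum>i=1..7. b i) - (b i + b j + b k))) (\<lambda>i. e i c y))"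
proof -
  have u: "1 - a * m\<^sup>2 * t > 0" using assms by (simp add: power_domain_def)
  then show ?thesis
    by (subst hodge_weighted_g2_form_scale[OF e, where r = "\<lambda>i. (1 - a * m\<^sup>2 * t) powr b i"])
      (simp_all add: power_coframe_def scale_form_def[abs_def] powr_add powr_diff powr_sum del: One_nat_def)
qed

lemma deriv_power_g2:
  assumes t: "t \<in> power_domain m a"
  shows "((\<lambda>s. power_g2 m a b e s c y vs) has_real_derivative
    - (a * m\<^sup>2) / (1 - a * m\<^sup>2 * t) *
      weighted_g2_form (\<lambda>i j k. b i + b j + b k) (\<lambda>i. power_coframe m a b e t i c y) vs) (at t)"
proof (rule has_field_derivative_transform_within_open[OF _ open_power_domain t])
  let ?u = "\<lambda>s. 1 - a * m\<^sup>2 * s"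
  show "weighted_g2_form (\<lambda>i j k. ?u s powr (b i + b j + b k)) (\<lambda>i. e i c y) vs
      = power_g2 m a b e s c y vs" if "s \<in> power_domain m a" for s
    using power_g2_eq_weighted[OF that, of "\<lambda>_ _ _. 1"]
    by (simp add: power_g2_def g2_structure_def g2_form_eq_weighted)
  have u: "?u t > 0" using t by (simp add: power_domain_def)
  have "((\<lambda>s. weighted_g2_form (\<lambda>i j k. ?u s powr (b i + b j + b k)) (\<lambda>i. e i c y) vs)
      has_real_derivative weighted_g2_form (\<lambda>i j k. - (a * m\<^sup>2) / ?u t *
        ((b i + b j + b k) * ?u t powr (b i + b j + b k))) (\<lambda>i. e i c y) vs) (at t)"
    unfolding weighted_g2_form_def
    by (intro DERIV_add DERIV_diff DERIV_cmult_right deriv_power[OF u])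
  then show "((\<lambda>s. weighted_g2_form (\<lambda>i j k. ?u s powr (b i + b j + b k)) (\<lambda>i. e i c y) vs)
      has_real_derivative - (a * m\<^sup>2) / ?u t *
      weighted_g2_form (\<lambda>i j k. b i + b j + b k) (\<lambda>i. power_coframe m a b e t i c y) vs) (at t)"
    by (simp only: weighted_g2_form_times power_g2_eq_weighted[OF t])
qed

text \<open>Here the star moves with time as well. Passing to the fixed coframe \<open>e\<close>
  turns its motion into complementary exponents, after which a constant linear operator is applied
  to a form with varying weights.\<close>

lemma deriv_star_power_g2:
  assumes t: "t \<in> power_domain m a"
  shows "((\<lambda>s. star (power_coframe m a b e s) (power_g2 m a b e s) c y vs) has_real_derivative
    - (a * m\<^sup>2) / (1 - a * m\<^sup>2 * t) *
      hodge (\<lambda>i. power_coframe m a b e t i c y) (weighted_g2_form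
        (\<lambda>i j k. (\<Sum>i=1..7. b i) - (b i + b j + b k)) (\<lambda>i. power_coframe m a b e t i c y)) vs) (at t)"
proof (rule has_field_derivative_transform_within_open[OF _ open_power_domain t])
  let ?u = "\<lambda>s. 1 - a * m\<^sup>2 * s" and ?q = "\<lambda>i j k. (\<Sum>i=1..7. b i) - (b i + b j + b k)"
  let ?e = "\<lambda>i. e i c y"
  show "hodge ?e (weighted_g2_form (\<lambda>i j k. ?u s powr ?q i j k) ?e) vs
      = star (power_coframe m a b e s) (power_g2 m a b e s) c y vs" if "s \<in> power_domain m a" for s
    using hodge_power_g2_eq_weighted[OF that, of "\<lambda>_ _ _. 1"]
    by (simp add: power_g2_def g2_structure_def g2_form_eq_weighted star_def)
  have u: "?u t > 0" using t by (simp add: power_domain_def)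
  have "((\<lambda>s. hodge ?e (weighted_g2_form (\<lambda>i j k. ?u s powr ?q i j k) ?e) vs)
      has_real_derivative hodge ?e (weighted_g2_form (\<lambda>i j k. - (a * m\<^sup>2) / ?u t *
        (?q i j k * ?u t powr ?q i j k)) ?e) vs) (at t)"
    unfolding hodge_weighted_g2_form
    by (intro DERIV_add DERIV_diff DERIV_cmult_right deriv_power[OF u])
  also have "hodge ?e (weighted_g2_form (\<lambda>i j k. - (a * m\<^sup>2) / ?u t *
        (?q i j k * ?u t powr ?q i j k)) ?e) vs = - (a * m\<^sup>2) / ?u t *
      hodge ?e (weighted_g2_form (\<lambda>i j k. ?q i j k * ?u t powr ?q i j k) ?e) vs"
    unfolding weighted_g2_form_times hodge_def by (simp only: sum_distrib_left mult.assoc)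
  finally show "((\<lambda>s. hodge ?e (weighted_g2_form (\<lambda>i j k. ?u s powr ?q i j k) ?e) vs)
      has_real_derivative - (a * m\<^sup>2) / ?u t *
      hodge (\<lambda>i. power_coframe m a b e t i c y) (weighted_g2_form ?q
        (\<lambda>i. power_coframe m a b e t i c y)) vs) (at t)"
    by (simp only: hodge_power_g2_eq_weighted[OF t])
qed

end

section \<open>Invariance of the flows under homothety\<close>

lemma diff_form_smooth_form:
  "diff_form A k \<omega> \<Longrightarrow> c \<in> A \<Longrightarrow> smooth_form (chart_image c) k (\<omega> c)"
  by (simp add: diff_form_def smooth_form_def)

lemma coord_rep_in_image: "y \<in> coord_domain f c c' \<Longrightarrow> coord_rep f c c' y \<in> chart_image c'"
  by (simp add: coord_domain_def coord_rep_def)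

lemma diff_form_scale:
  assumes "\<And>c. c \<in> A \<Longrightarrow> open (chart_image c)" "diff_form A k \<omega>"
    and \<eta>: "\<And>c y. c \<in> A \<Longrightarrow> y \<in> chart_image c \<Longrightarrow> \<eta> c y = (\<lambda>vs. q * \<omega> c y vs)"
  shows "diff_form A k \<eta>"
proof -
  have "smooth_form (chart_image c) k (\<eta> c)" if c: "c \<in> A" for c
    using \<eta>[OF c]
    by (intro smooth_form_cong[OF assms(1)[OF c] _
        smooth_form_scale[OF diff_form_smooth_form[OF assms(2) c], of q]]) simp
  moreover have "pullback_invariant A id \<eta>"
    unfolding pullback_invariant_def
  proof (intro ballI allI)
    fix c c' y vs assume *: "c \<in> A" "c' \<in> A" "y \<in> coord_domain id c c'"
    then have "y \<in> chart_image c" by (simp add: coord_domain_def)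
    then show "\<eta> c y vs =
        \<eta> c' (coord_rep id c c' y) (map (frechet_derivative (coord_rep id c c') (at y)) vs)"
      using assms(2) * coord_rep_in_image[OF *(3)]
      by (simp add: \<eta> diff_form_def pullback_invariant_def)
  qed
  ultimately show ?thesis by (simp add: diff_form_def smooth_form_def)
qed

text \<open>Both defining equations are linear in the form once \<tau> is fixed, so the same Lee
  form serves, and rescaling an adapted coframe by \<open>r\<close> gives an adapted coframe of the
  new structure.\<close>

lemma lcp_homothety:
  assumes charts: "\<And>c. c \<in> A \<Longrightarrow> open (chart_image c)" and r: "r \<noteq> 0"
    and \<phi>': "\<And>c y. c \<in> A \<Longrightarrow> y \<in> chart_image c \<Longrightarrow> \<phi>' c y = (\<lambda>vs. r ^ 3 * \<phi> c y vs)"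
    and lcp: "lcp A \<phi>"
  shows "lcp A \<phi>'"
proof -
  obtain \<psi> \<tau> where \<phi>: "diff_form A 3 \<phi>" and \<psi>: "diff_form A 4 \<psi>" and \<tau>: "diff_form A 1 \<tau>"
    and x: "\<forall>c\<in>A. \<forall>y\<in>chart_image c. \<exists>x. coframe x \<and> \<phi> c y = g2_form x \<and> \<psi> c y = hodge x (\<phi> c y)"
    and d\<phi>: "form_eq A (ext_deriv \<phi>) (scale_form 3 (wedge_form \<tau> \<phi>))"
    and d\<psi>: "form_eq A (ext_deriv \<psi>) (scale_form 4 (wedge_form \<tau> \<psi>))"
    using lcp unfolding lcp_def by blast
  \<comment> \<open>The 3-form contributes r^3, and the star in degree 3 the factor r^7 / r^6 =
    r.\<close>
  define \<psi>' where "\<psi>' = scale_form (r ^ 4) \<psi>"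
  have \<psi>': "\<psi>' c y = (\<lambda>vs. r ^ 4 * \<psi> c y vs)" for c y
    by (simp add: \<psi>'_def scale_form_def fun_eq_iff)
  have lee: "form_eq A (ext_deriv \<eta>) (scale_form a (wedge_form \<tau> \<eta>))"
    if "diff_form A k \<omega>" "form_eq A (ext_deriv \<omega>) (scale_form a (wedge_form \<tau> \<omega>))"
      "\<And>c y. c \<in> A \<Longrightarrow> y \<in> chart_image c \<Longrightarrow> \<eta> c y = (\<lambda>vs. q * \<omega> c y vs)" for k \<omega> \<eta> a q
    unfolding form_eq_def
  proof (intro ballI)
    fix c y assume c: "c \<in> A" and y: "y \<in> chart_image c"
    have "ext_deriv \<eta> c y = (\<lambda>vs. q * ext_deriv \<omega> c y vs)"
      using that(3)[OF c]
      by (intro ext_deriv_scale[where \<omega> = \<omega>, OF charts[OF c] y diff_form_smooth_form[OF that(1) c]])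
    also have "\<dots> = scale_form a (wedge_form \<tau> \<eta>) c y"
      using that(2)[unfolded form_eq_def, rule_format, OF c y]
      by (simp add: scale_form_def wedge_form_def that(3)[OF c y] wedge_scale fun_eq_iff)
    finally show "ext_deriv \<eta> c y = scale_form a (wedge_form \<tau> \<eta>) c y" .
  qed
  have "\<exists>x. coframe x \<and> \<phi>' c y = g2_form x \<and> \<psi>' c y = hodge x (\<phi>' c y)"
    if c: "c \<in> A" and y: "y \<in> chart_image c" for c y
  proof -
    obtain x where x: "coframe x" "\<phi> c y = g2_form x" "\<psi> c y = hodge x (\<phi> c y)"
      using x c y by blast
    define x' where "x' i = (\<lambda>vs. r * x i vs)" for i
    have "coframe x'" by (rule coframe_scale[where r = "\<lambda>_. r", OF x(1)]) (simp_all add: r x'_def)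
    moreover have "\<phi>' c y = g2_form x'"
      unfolding \<phi>'[OF c y] x(2)
      by (rule g2_form_homothety[symmetric]) (simp add: x'_def)
    moreover have "\<psi>' c y = hodge x' (\<phi>' c y)"
    proof
      fix vs
      have alt: "alternating_form 3 (\<phi>' c y)"
        using smooth_form_alternating[OF diff_form_smooth_form[OF \<phi> c] y]
        by (simp add: \<phi>'[OF c y] alternating_form_scale)
      have "hodge x' (\<phi>' c y) vs = r ^ 7 / r ^ (2 * 3) * hodge x (\<phi>' c y) vs"
        by (rule hodge_homothety[OF x(1) r _ alt]) (simp add: x'_def)
      also have "hodge x (\<phi>' c y) vs = r ^ 3 * \<psi> c y vs"
        by (simp add: \<phi>'[OF c y] x(3) hodge_def sum_distrib_left mult.assoc)
      also have "r ^ 7 / r ^ (2 * 3) = r" using r by (simp add: eval_nat_numeral)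
      finally show "\<psi>' c y vs = hodge x' (\<phi>' c y) vs"
        by (simp add: \<psi>' eval_nat_numeral)
    qed
    ultimately show ?thesis by blast
  qed
  moreover have "diff_form A 3 \<phi>'" "diff_form A 4 \<psi>'"
    using diff_form_scale[OF charts \<phi> \<phi>'] diff_form_scale[OF charts \<psi> \<psi>'] by blast+
  ultimately show ?thesis
    unfolding lcp_def using \<tau> lee[OF \<phi> d\<phi> \<phi>'] lee[OF \<psi> d\<psi> \<psi>'] by blast
qed

lemma lcp_cong:
  assumes "\<And>c. c \<in> A \<Longrightarrow> open (chart_image c)"
    and "\<And>c y. c \<in> A \<Longrightarrow> y \<in> chart_image c \<Longrightarrow> \<phi>' c y = \<phi> c y"
  shows "lcp A \<phi>' \<longleftrightarrow> lcp A \<phi>"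
proof
  show "lcp A \<phi>" if "lcp A \<phi>'"
    by (rule lcp_homothety[OF assms(1) _ _ that, of 1]) (simp_all add: assms(2))
  show "lcp A \<phi>'" if "lcp A \<phi>"
    by (rule lcp_homothety[OF assms(1) _ _ that, of 1]) (simp_all add: assms(2))
qed

lemma smooth_coframe_scale:
  assumes U: "open U" and x: "smooth_coframe U x" and r: "\<And>i. i \<in> {1..7} \<Longrightarrow> r i \<noteq> 0"
  shows "smooth_coframe U (\<lambda>i y vs. r i * x i y vs)"
  unfolding smooth_coframe_def
proof (intro conjI ballI)
  show "smooth_form U 1 (\<lambda>y vs. r i * x i y vs)" if "i \<in> {1..7}" for i
    using x that unfolding smooth_coframe_def by (intro smooth_form_scale) blast
  show "coframe (\<lambda>i vs. r i * x i y vs)" if "y \<in> U" for y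
  proof -
    have "coframe (\<lambda>i. x i y)" using x that by (simp add: smooth_coframe_def)
    from coframe_scale[where r = r, OF this] show ?thesis using r by simp
  qed
qed

lemma smooth_coframe_power:
  assumes "open U" "smooth_coframe U (\<lambda>i. e i c)" "t \<in> power_domain m a"
  shows "smooth_coframe U (\<lambda>i. power_coframe m a b e t i c)"
  using smooth_coframe_scale[OF assms(1,2), of "\<lambda>i. (1 - a * m\<^sup>2 * t) powr b i"] assms(3)
  by (simp add: power_coframe_def scale_form_def[abs_def] power_domain_def)

lemma smooth_power_g2:
  assumes "open U" "smooth_coframe U (\<lambda>i. e i c)" "t \<in> power_domain m a"
  shows "smooth_form U 3 (power_g2 m a b e t c)"
  using smooth_weighted_g2_form[OF assms(1) smooth_coframe_power[where e = e and c = c, OF assms], of "\<lambda>_ _ _. 1"]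
  by (simp add: power_g2_def g2_structure_def[abs_def] g2_form_eq_weighted)

section \<open>The two families at matched times\<close>

locale dual_powers =
  fixes A :: "'s chart set" and e :: "nat \<Rightarrow> 's dform" and m \<alpha> \<gamma> :: real and \<beta> \<delta> :: "nat \<Rightarrow> real"
  assumes charts: "\<And>c. c \<in> A \<Longrightarrow> open (chart_image c)"
    and e: "\<And>c. c \<in> A \<Longrightarrow> smooth_coframe (chart_image c) (\<lambda>i. e i c)"
    and m: "m \<noteq> 0" and B: "(\<Sum>j=1..7. \<beta> j) \<noteq> 2"
    and \<gamma>: "\<gamma> = \<alpha> * ((2 - (\<Sum>i=1..7. \<beta> i)) / 2)"
    and \<delta>: "\<forall>i\<in>{1..7}. \<delta> i = 1/2 + (1 - 2 * \<beta> i) / (-2 + (\<Sum>j=1..7. \<beta> j))"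
begin

text \<open>The times are matched so that \<open>1 - \<alpha> m\<^sup>2 t = (1 - \<gamma> m\<^sup>2 t') powr \<kappa>\<close>. When \<open>\<alpha> = 0\<close> both families
  are constant and any two times match.\<close>

definition \<kappa> :: real where "\<kappa> = 2 / (2 - (\<Sum>j=1..7. \<beta> j))"

text \<open>This is \<gamma> times the statement that the complementary exponents of \<delta> add up
  to - \<kappa> (\<beta>_i + \<beta>_j + \<beta>_k), with \<gamma> \<kappa> = \<alpha>. The proof
  multiplies by \<open>S - 2\<close>, which is - 2 / \<kappa>, to clear denominators.\<close>

lemma \<gamma>_weight:
  assumes "i \<in> {1..7}" "j \<in> {1..7}" "k \<in> {1..7}"
  shows "\<gamma> * ((\<Sum>l=1..7. \<delta> l) - (\<delta> i + \<delta> j + \<delta> k)) = - \<alpha> * (\<beta> i + \<beta> j + \<beta> k)"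
proof -
  define S where "S = (\<Sum>l=1..7. \<beta> l)"
  have S: "S - 2 \<noteq> 0" using B by (simp add: S_def)
  have "(\<Sum>l=1..7. \<delta> l) = (\<Sum>l=1..7. 1/2 + (1 - 2 * \<beta> l) / (S - 2))"
    using \<delta> by (intro sum.cong) (auto simp: S_def)
  also have "\<dots> = 7/2 + (\<Sum>l=1..7. 1 - 2 * \<beta> l) / (S - 2)"
    by (simp add: sum.distrib flip: sum_divide_distrib)
  also have "(\<Sum>l=1..7. 1 - 2 * \<beta> l) = 7 - 2 * S"
    by (simp add: sum_subtractf S_def flip: sum_distrib_left)
  finally have "(S - 2) * (\<Sum>l=1..7. \<delta> l) = 7/2 * (S - 2) + (7 - 2 * S)"
    using S by (simp add: distrib_left)
  moreover have "(S - 2) * \<delta> l = 1/2 * (S - 2) + (1 - 2 * \<beta> l)" if "l \<in> {1..7}" for l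
    using \<delta> that S by (simp add: S_def distrib_left)
  note this[OF assms(1)] this[OF assms(2)] this[OF assms(3)]
  ultimately have "(S - 2) * ((\<Sum>l=1..7. \<delta> l) - (\<delta> i + \<delta> j + \<delta> k)) = 2 * (\<beta> i + \<beta> j + \<beta> k)"
    unfolding right_diff_distrib distrib_left by linarith
  moreover have "\<gamma> = - \<alpha> / 2 * (S - 2)" by (simp add: \<gamma> S_def field_simps)
  ultimately show ?thesis by (simp add: mult.assoc)
qed

context
  fixes t t' :: real
  assumes t: "t \<in> power_domain m \<alpha>" and t': "t' \<in> power_domain m \<gamma>"
    and tt': "1 - \<alpha> * m\<^sup>2 * t = (1 - \<gamma> * m\<^sup>2 * t') powr \<kappa>"
begin

abbreviation (input) u where "u \<equiv> 1 - \<alpha> * m\<^sup>2 * t"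
abbreviation (input) v where "v \<equiv> 1 - \<gamma> * m\<^sup>2 * t'"

text \<open>The quotient of \<open>v powr \<delta> i\<close> by \<open>u powr \<beta> i\<close>. It
  is the same for all \<open>i\<close>, because \<delta>_i = (1 - \<kappa>) / 2 + \<kappa> \<beta>_i
  and \<open>u = v powr \<kappa>\<close>.\<close>

definition r :: real where "r = v powr (1/2 - \<kappa> / 2)"

lemma r_pos: "r > 0" and u_pos: "u > 0" and v_pos: "v > 0"
  using t t' by (simp_all add: r_def power_domain_def)

lemma r_square: "r\<^sup>2 = v / u"
proof -
  have "r\<^sup>2 = v powr (1/2 - \<kappa> / 2 + (1/2 - \<kappa> / 2))"
    by (simp only: r_def power2_eq_square powr_add)
  also have "1/2 - \<kappa> / 2 + (1/2 - \<kappa> / 2) = 1 - \<kappa>" by simp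
  finally show ?thesis using v_pos by (simp add: tt' powr_diff)
qed

lemma power_coframe_homothety:
  assumes "i \<in> {1..7}"
  shows "power_coframe m \<gamma> \<delta> e t' i c y = (\<lambda>vs. r * power_coframe m \<alpha> \<beta> e t i c y vs)"
proof -
  have "1/2 + (1 - 2 * \<beta> i) / (-2 + (\<Sum>j=1..7. \<beta> j)) = (1/2 - \<kappa> / 2) + \<kappa> * \<beta> i"
    using B by (simp add: \<kappa>_def divide_simps) (simp add: algebra_simps)
  then have "\<delta> i = (1/2 - \<kappa> / 2) + \<kappa> * \<beta> i" using \<delta> assms by simp
  then have "v powr \<delta> i = r * u powr \<beta> i"
    by (simp only: tt' r_def powr_powr powr_add)
  then show ?thesis by (simp add: power_coframe_def scale_form_def mult.assoc fun_eq_iff)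
qed

lemma weighted_homothety:
  "weighted_g2_form w (\<lambda>i. power_coframe m \<gamma> \<delta> e t' i c y)
    = (\<lambda>vs. r ^ 3 * weighted_g2_form w (\<lambda>i. power_coframe m \<alpha> \<beta> e t i c y) vs)"
  by (rule weighted_g2_form_homothety) (rule power_coframe_homothety)

lemma power_g2_homothety: "power_g2 m \<gamma> \<delta> e t' c y = (\<lambda>vs. r ^ 3 * power_g2 m \<alpha> \<beta> e t c y vs)"
  using weighted_homothety by (simp add: power_g2_def g2_structure_def g2_form_eq_weighted)

lemma lcp_iff: "lcp A (power_g2 m \<alpha> \<beta> e t) \<longleftrightarrow> lcp A (power_g2 m \<gamma> \<delta> e t')"
proof
  show "lcp A (power_g2 m \<gamma> \<delta> e t')" if "lcp A (power_g2 m \<alpha> \<beta> e t)"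
    using r_pos power_g2_homothety by (intro lcp_homothety[OF charts _ _ that, of r]) auto
  show "lcp A (power_g2 m \<alpha> \<beta> e t)" if "lcp A (power_g2 m \<gamma> \<delta> e t')"
    using r_pos power_g2_homothety
    by (intro lcp_homothety[OF charts _ _ that, of "1 / r"]) (auto simp: power_divide)
qed

lemma lcp_star_iff:
  "lcp A (star (power_coframe m \<gamma> \<delta> e t') (star (power_coframe m \<gamma> \<delta> e t') (power_g2 m \<gamma> \<delta> e t')))
    \<longleftrightarrow> lcp A (power_g2 m \<gamma> \<delta> e t')"
proof (rule lcp_cong[OF charts])
  fix c y assume c: "c \<in> A" and y: "y \<in> chart_image c"
  note sm = charts[OF c] smooth_coframe_power[where e = e and c = c, OF charts[OF c] e[OF c] t']
    smooth_power_g2[where e = e and c = c, OF charts[OF c] e[OF c] t']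
  show "star (power_coframe m \<gamma> \<delta> e t') (star (power_coframe m \<gamma> \<delta> e t') (power_g2 m \<gamma> \<delta> e t')) c y
      = power_g2 m \<gamma> \<delta> e t' c y"
    by (rule star_star[where x = "power_coframe m \<gamma> \<delta> e t'" and \<omega> = "power_g2 m \<gamma> \<delta> e t'"
          and c = c, OF sm(1) sm(2) sm(3) _ y]) simp
qed

lemma deriv_iff:
  "form_deriv_at A (power_g2 m \<alpha> \<beta> e) (hodge_laplacian (power_coframe m \<alpha> \<beta> e t) (power_g2 m \<alpha> \<beta> e t)) t
    \<longleftrightarrow> form_deriv_at A (\<lambda>t. star (power_coframe m \<gamma> \<delta> e t) (power_g2 m \<gamma> \<delta> e t))
      (scale_form (-1) (hodge_laplacian (power_coframe m \<gamma> \<delta> e t')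
        (star (power_coframe m \<gamma> \<delta> e t') (power_g2 m \<gamma> \<delta> e t')))) t'"
  (is "form_deriv_at A ?\<phi> ?L t \<longleftrightarrow> form_deriv_at A ?\<psi>' ?L' t'")
proof -
  let ?x = "power_coframe m \<alpha> \<beta> e t" and ?x' = "power_coframe m \<gamma> \<delta> e t'"
  let ?w = "\<lambda>i j k. \<beta> i + \<beta> j + \<beta> k"
  have "(\<forall>vs. ((\<lambda>s. ?\<phi> s c y vs) has_real_derivative ?L c y vs) (at t)) \<longleftrightarrow>
      (\<forall>vs. ((\<lambda>s. ?\<psi>' s c y vs) has_real_derivative ?L' c y vs) (at t'))"
    if c: "c \<in> A" and y: "y \<in> chart_image c" for c y
  proof -
    note U = charts[OF c]
    note x = smooth_coframe_power[where e = e and c = c, OF U e[OF c] t, of \<beta>]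
    note x' = smooth_coframe_power[where e = e and c = c, OF U e[OF c] t', of \<delta>]
    note \<phi> = smooth_power_g2[where e = e and c = c, OF U e[OF c] t, of \<beta>]
    note \<phi>' = smooth_power_g2[where e = e and c = c, OF U e[OF c] t', of \<delta>]
    have ecy: "coframe (\<lambda>i. e i c y)" using e[OF c] y unfolding smooth_coframe_def by blast
    have x'y: "coframe (\<lambda>i. ?x' i c y)" using x' y unfolding smooth_coframe_def by blast
    let ?W = "weighted_g2_form ?w (\<lambda>i. ?x i c y)" and ?W' = "weighted_g2_form ?w (\<lambda>i. ?x' i c y)"
    let ?D' = "hodge_laplacian ?x' (power_g2 m \<gamma> \<delta> e t') c y"
    let ?V' = "\<lambda>vs. - (\<alpha> * m\<^sup>2) / v * ?W' vs"
    \<comment> \<open>The derivative is known explicitly, so by uniqueness the flow equation becomes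
      an identity between two forms at one time.\<close>
    have "((\<lambda>s. ?\<phi> s c y vs) has_real_derivative d) (at t) \<longleftrightarrow> d = - (\<alpha> * m\<^sup>2) / u * ?W vs" for d vs
      using deriv_power_g2[where e = e and c = c and y = y and vs = vs, OF ecy t] DERIV_unique by blast
    then have flow: "(\<forall>vs. ((\<lambda>s. ?\<phi> s c y vs) has_real_derivative ?L c y vs) (at t))
        \<longleftrightarrow> (\<forall>vs. ?L c y vs = - (\<alpha> * m\<^sup>2) / u * ?W vs)" by simp
    have weights: "weighted_g2_form (\<lambda>i j k. \<gamma> * ((\<Sum>l=1..7. \<delta> l) - (\<delta> i + \<delta> j + \<delta> k))) z
        = weighted_g2_form (\<lambda>i j k. - \<alpha> * ?w i j k) z" for z
      by (rule weighted_g2_form_cong) (rule \<gamma>_weight)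
    have "- (\<gamma> * m\<^sup>2) / v * hodge (\<lambda>i. ?x' i c y)
          (weighted_g2_form (\<lambda>i j k. (\<Sum>l=1..7. \<delta> l) - (\<delta> i + \<delta> j + \<delta> k)) (\<lambda>i. ?x' i c y)) vs
        = - hodge (\<lambda>i. ?x' i c y) ?V' vs" for vs
    proof -
      let ?h = "\<lambda>\<omega>. hodge (\<lambda>i. ?x' i c y) \<omega> vs"
      let ?Z = "weighted_g2_form (\<lambda>i j k. (\<Sum>l=1..7. \<delta> l) - (\<delta> i + \<delta> j + \<delta> k)) (\<lambda>i. ?x' i c y)"
      have h: "?h (\<lambda>vs. q * \<omega> vs) = q * ?h \<omega>" for q \<omega>
        by (simp add: hodge_def sum_distrib_left mult.assoc)
      \<comment> \<open>By linearity \<gamma> moves through the star into the weights, where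
        \<open>\<gamma>_weight\<close> trades complementary exponents for those of the 3-form, and -
        \<alpha> moves out again.\<close>
      have "\<gamma> * ?h ?Z = - \<alpha> * ?h ?W'"
        using weights[of "\<lambda>i. ?x' i c y"] unfolding weighted_g2_form_times h[symmetric] by simp
      then have "- m\<^sup>2 / v * (\<gamma> * ?h ?Z) = - m\<^sup>2 / v * (- \<alpha> * ?h ?W')" by simp
      then show ?thesis unfolding h by (simp add: mult_ac)
    qed
    then have "((\<lambda>s. ?\<psi>' s c y vs) has_real_derivative - hodge (\<lambda>i. ?x' i c y) ?V' vs) (at t')" for vs
      using deriv_star_power_g2[where e = e and c = c and y = y and vs = vs, OF ecy t', of \<delta>] by simp
    then have "((\<lambda>s. ?\<psi>' s c y vs) has_real_derivative d) (at t')
        \<longleftrightarrow> d = - hodge (\<lambda>i. ?x' i c y) ?V' vs" for d vs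
      using DERIV_unique by blast
    moreover have "?L' c y vs = - hodge (\<lambda>i. ?x' i c y) ?D' vs" for vs
      using hodge_laplacian_star[where x = ?x' and \<omega> = "power_g2 m \<gamma> \<delta> e t'" and c = c,
          OF U x' \<phi>' _ _ y] by (simp add: scale_form_def star_def)
    ultimately have "(\<forall>vs. ((\<lambda>s. ?\<psi>' s c y vs) has_real_derivative ?L' c y vs) (at t'))
        \<longleftrightarrow> hodge (\<lambda>i. ?x' i c y) ?D' = hodge (\<lambda>i. ?x' i c y) ?V'" by (simp add: fun_eq_iff)
    also have "\<dots> \<longleftrightarrow> ?D' = ?V'"
    proof -
      let ?H = "hodge (\<lambda>i. ?x' i c y)"
      \<comment> \<open>The star is an involution on 3-forms, hence injective there, and can be
        cancelled from both sides.\<close>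
      have "alternating_form 3 ?D'"
        using smooth_form_alternating[OF smooth_form_hodge_laplacian[where x = ?x' and c = c
            and \<omega> = "power_g2 m \<gamma> \<delta> e t'", OF U x' \<phi>'] y] by simp
      moreover have "alternating_form 3 ?V'"
        using smooth_form_alternating[OF smooth_weighted_g2_form[OF U x'] y]
        by (rule alternating_form_scale)
      ultimately have "?H (?H ?D') = ?D'" "?H (?H ?V') = ?V'"
        by (auto intro: hodge_hodge[OF x'y])
      then show ?thesis by metis
    qed
    also have "\<dots> \<longleftrightarrow> (\<forall>vs. ?L c y vs = - (\<alpha> * m\<^sup>2) / u * ?W vs)"
    proof -
      have D': "?D' vs = r ^ 3 / r\<^sup>2 * ?L c y vs" for vs
        by (rule hodge_laplacian_homothety[where x = ?x and x' = ?x' and \<omega> = "power_g2 m \<alpha> \<beta> e t"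
              and \<omega>' = "power_g2 m \<gamma> \<delta> e t'" and c = c and r = r,
              OF U x _ power_coframe_homothety \<phi> _ _ y power_g2_homothety]) (use r_pos in auto)
      \<comment> \<open>The Laplacian changes by r^3 / r^2 = r. The other side changes by r^3 with
        \<open>u\<close> replaced by \<open>v\<close>, and r^2 = v / u turns this into the same
        factor r, which cancels.\<close>
      have "- (\<alpha> * m\<^sup>2) / v * r ^ 3 = r * (- (\<alpha> * m\<^sup>2) / v * r\<^sup>2)"
        by (simp add: power3_eq_cube power2_eq_square)
      also have "\<dots> = r * (- (\<alpha> * m\<^sup>2) / u)"
        using v_pos u_pos by (simp add: r_square)
      finally have "?V' vs = r * (- (\<alpha> * m\<^sup>2) / u * ?W vs)" for vs
        unfolding weighted_homothety by (simp only: mult.assoc[symmetric])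
      moreover have "r ^ 3 / r\<^sup>2 = r" using r_pos by (simp add: power3_eq_cube power2_eq_square)
      ultimately have "?D' vs = ?V' vs \<longleftrightarrow> ?L c y vs = - (\<alpha> * m\<^sup>2) / u * ?W vs" for vs
        using r_pos unfolding D' by (simp only: mult_cancel_left) simp
      then show ?thesis by (simp only: fun_eq_iff)
    qed
    finally show ?thesis using flow by simp
  qed
  then show ?thesis unfolding form_deriv_at_def by blast
qed

end

lemma powr_pos_inverse: "u > 0 \<Longrightarrow> (u powr (1 / \<kappa>)) powr \<kappa> = u" for u :: real
proof -
  have "\<kappa> \<noteq> 0" using B by (simp add: \<kappa>_def)
  then show "u > 0 \<Longrightarrow> (u powr (1 / \<kappa>)) powr \<kappa> = u" by (simp add: powr_powr)
qed

lemma ex_dual_time: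
  assumes "t \<in> power_domain m \<alpha>"
  shows "\<exists>t'\<in>power_domain m \<gamma>. 1 - \<alpha> * m\<^sup>2 * t = (1 - \<gamma> * m\<^sup>2 * t') powr \<kappa>"
proof -
  let ?u = "1 - \<alpha> * m\<^sup>2 * t"
  have u: "?u > 0" using assms by (simp add: power_domain_def)
  have "\<exists>t'. 1 - \<gamma> * m\<^sup>2 * t' = ?u powr (1 / \<kappa>)"
  proof (cases "\<alpha> = 0")
    case False
    then have "\<gamma> * m\<^sup>2 \<noteq> 0" using m B by (simp add: \<gamma>)
    then show ?thesis by (intro exI[of _ "(1 - ?u powr (1 / \<kappa>)) / (\<gamma> * m\<^sup>2)"]) simp
  qed (simp add: \<gamma>)
  then obtain t' where t': "1 - \<gamma> * m\<^sup>2 * t' = ?u powr (1 / \<kappa>)" by blast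
  then have "1 - \<gamma> * m\<^sup>2 * t' > 0" using u by simp
  then have "t' \<in> power_domain m \<gamma>" by (simp add: power_domain_def)
  moreover have "?u = (1 - \<gamma> * m\<^sup>2 * t') powr \<kappa>"
    unfolding t' by (rule powr_pos_inverse[OF u, symmetric])
  ultimately show ?thesis by blast
qed

lemma ex_dual_time':
  assumes "t' \<in> power_domain m \<gamma>"
  shows "\<exists>t\<in>power_domain m \<alpha>. 1 - \<alpha> * m\<^sup>2 * t = (1 - \<gamma> * m\<^sup>2 * t') powr \<kappa>"
proof (cases "\<alpha> = 0")
  case True
  then show ?thesis by (auto simp: \<gamma> power_domain_def)
next
  case False
  define v where "v = 1 - \<gamma> * m\<^sup>2 * t'"
  have "v > 0" using assms by (simp add: power_domain_def v_def)
  moreover have "1 - \<alpha> * m\<^sup>2 * ((1 - v powr \<kappa>) / (\<alpha> * m\<^sup>2)) = v powr \<kappa>" using False m by simp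
  ultimately show ?thesis
    unfolding v_def[symmetric]
    by (intro bexI[of _ "(1 - v powr \<kappa>) / (\<alpha> * m\<^sup>2)"]) (simp_all add: power_domain_def)
qed

text \<open>Every time of either family has a match in the other, which is enough to carry the
  quantifiers across. A relation in place of a map also accommodates \<open>\<alpha> = 0\<close>,
  where a time has many matches.\<close>

lemma dual_times_iff:
  assumes "\<And>t t'. t \<in> power_domain m \<alpha> \<Longrightarrow> t' \<in> power_domain m \<gamma> \<Longrightarrow>
    1 - \<alpha> * m\<^sup>2 * t = (1 - \<gamma> * m\<^sup>2 * t') powr \<kappa> \<Longrightarrow> P t \<longleftrightarrow> Q t'"
  shows "(\<forall>t\<in>power_domain m \<alpha>. P t) \<longleftrightarrow> (\<forall>t'\<in>power_domain m \<gamma>. Q t')"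
  using assms ex_dual_time ex_dual_time' by meson

end

theorem theorem4p1:
  fixes G :: "('s, 'r) monoid_scheme" and T :: "'s topology" and A :: "'s chart set"
    and e :: "nat \<Rightarrow> 's dform"
    and s :: nat and m \<alpha> \<gamma> :: real and \<beta> \<delta> :: "nat \<Rightarrow> real"
  assumes "m \<noteq> 0" and "s \<in> {1..7}"
    and "lie_group G T A" and "solvable G"
    and "left_invariant_basis G A e" and "structure_equations A (cp s m) e"
    and "\<beta> 7 = 1/2" and "\<delta> 7 = 1/2" and "(\<Sum>j=1..7. \<beta> j) \<noteq> 2"
    and "\<gamma> = \<alpha> * ((2 - (\<Sum>i=1..7. \<beta> i)) / 2)"
    and "\<forall>i\<in>{1..7}. \<delta> i = 1/2 + (1 - 2 * \<beta> i) / (-2 + (\<Sum>j=1..7. \<beta> j))"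
  shows "((\<forall>t\<in>power_domain m \<alpha>. lcp A (power_g2 m \<alpha> \<beta> e t)) \<longleftrightarrow>
          (\<forall>t\<in>power_domain m \<gamma>. lcp A (power_g2 m \<gamma> \<delta> e t))) \<and>
         (laplacian_lcp_flow A (power_domain m \<alpha>)
            (power_coframe m \<alpha> \<beta> e) (power_g2 m \<alpha> \<beta> e) \<longleftrightarrow>
          laplacian_lcp_coflow A (power_domain m \<gamma>) (power_coframe m \<gamma> \<delta> e)
            (\<lambda>t. star (power_coframe m \<gamma> \<delta> e t) (power_g2 m \<gamma> \<delta> e t)))"
proof -
  interpret dual_powers A e m \<alpha> \<gamma> \<beta> \<delta>
  proof
    fix c assume c: "c \<in> A"
    then show "open (chart_image c)"
      using assms(3) by (auto simp: lie_group_def smooth_manifold_def is_chart_def)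
    show "smooth_coframe (chart_image c) (\<lambda>i. e i c)"
      using assms(5) c unfolding smooth_coframe_def left_invariant_basis_def
      by (auto intro!: diff_form_smooth_form simp del: One_nat_def)
  qed (use assms in auto)
  have "laplacian_lcp_flow A (power_domain m \<alpha>) (power_coframe m \<alpha> \<beta> e) (power_g2 m \<alpha> \<beta> e) \<longleftrightarrow>
      laplacian_lcp_coflow A (power_domain m \<gamma>) (power_coframe m \<gamma> \<delta> e)
        (\<lambda>t. star (power_coframe m \<gamma> \<delta> e t) (power_g2 m \<gamma> \<delta> e t))"
    unfolding laplacian_lcp_flow_def laplacian_lcp_coflow_def
    by (rule dual_times_iff) (simp only: deriv_iff lcp_star_iff lcp_iff)
  moreover have "(\<forall>t\<in>power_domain m \<alpha>. lcp A (power_g2 m \<alpha> \<beta> e t)) \<longleftrightarrow>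
      (\<forall>t\<in>power_domain m \<gamma>. lcp A (power_g2 m \<gamma> \<delta> e t))"
    by (rule dual_times_iff) (rule lcp_iff)
  ultimately show ?thesis by blast
qed

end
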